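(* Let $\{t_i\approx u_i : i\in I\}$ be a set of equations between terms in the language $(\wedge,\vee,{}',0,1)$ of BI-lattices such that, for each $i\in I$, the terms $t_i$ and $u_i$ have nonzero arities. Then the following are equivalent: (1) $\{t_i\approx u_i:i\in I\}$ is an axiomatisation of $V_{\mathbb{BI}}(\mathbf{B}_6)$ relative to $\mathbb{OL}$, i.e. $V_{\mathbb{BI}}(\mathbf{B}_6)=\{\mathbf{L}\in\mathbb{OL}: \mathbf{L}\vDash t_i\approx u_i \text{ for all } i\in I\}$; (2) $\{m(t_i,u_i)\approx m(u_i,t_i): i\in I\}\cup\{\mathrm{J0},\mathrm{D2OL}\vee\}$ is an axiomatisation of $V_{\mathbb{BZL}}(\mathbf{F}_8)$ relative to $\mathbb{PBZL}^{\ast}$, i.e. $V_{\mathbb{BZL}}(\mathbf{F}_8)$ is the class of all members of $\mathbb{PBZL}^{\ast}$ satisfying all of these equations.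
   Context: A BI-lattice (bounded involution lattice) is an algebra $(L,\wedge,\vee,{}',0,1)$ of type $(2,2,1,0,0)$ with a bounded lattice reduct and an order-reversing operation $'$ with $a''=a$; $\mathbb{BI}$ is the variety of BI-lattices. A pseudo-Kleene algebra is a BI-lattice with $a\wedge a'\le b\vee b'$ for all $a,b$. $\mathbb{OL}$ is the variety of ortholattices: BI-lattices in which $a\vee a'=1$ for all $a$. A BZ-lattice is an algebra $(L,\wedge,\vee,{}',{}^{\sim},0,1)$ whose ${}^\sim$-free reduct is a pseudo-Kleene algebra and with ${}^\sim$ order-reversing and satisfying $a\wedge a^{\sim}=0$ and $a\le a^{\sim\sim}=a^{\sim\prime}$; $\mathbb{BZL}$ is the variety of BZ-lattices. Write $\Diamond a=a^{\sim\sim}$. A PBZ$^{\ast}$-lattice is a BZ-lattice that is paraorthomodular ($a\le b$ and $a'\wedge b=0$ imply $a=b$) and satisfies $(x\wedge x')^{\sim}\approx x^{\sim}\vee x'^{\sim}$; $\mathbb{PBZL}^{\ast}$ is the variety of PBZ$^{\ast}$-lattices. $V_{\mathbb{BI}}(\mathbf{A})$ (resp. $V_{\mathbb{BZL}}(\mathbf{A})$) is the variety generated by $\mathbf{A}$ in the language of BI-lattices (resp. BZ-lattices). $\mathbf{B}_6$ (benzene ring) is the ortholattice with six elements $0,a,b,a',b',1$, whose order is given by the two chains $0<a<b'<1$ and $0<b<a'<1$ with no other comparabilities. $\mathbf{F}_8=\mathbf{D}_2\oplus\mathbf{B}_6\oplus\mathbf{D}_2$ is obtained from $\mathbf{B}_6$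 by adding a new bottom $0$ and a new top $1$ with $0'=1$ and $1'=0$ (the involution on $\mathbf B_6$ being unchanged), equipped with the trivial Brouwer complement $0^{\sim}=1$, $x^{\sim}=0$ for $x\ne 0$. Equations: J0 is $(x\wedge y^{\sim})\vee(x\wedge\Diamond y)\approx x$; D2OL$\vee$ is $(x\wedge x')^{\sim}\vee(y\wedge y')^{\sim}\vee x\vee x'\approx (x\wedge x')^{\sim}\vee(y\wedge y')^{\sim}\vee y\vee y'$. For terms $t(x_1,\dots,x_k,z_1,\dots,z_p)$ and $u(y_1,\dots,y_n,z_1,\dots,z_p)$ in the language of BI-lattices, of arities $k+p$ and $n+p$ respectively, whose common variables are $z_1,\dots,z_p$, $m(t,u)$ is the following term in the language of BZ-lattices, in the variables $x_1,\dots,x_k,y_1,\dots,y_n,z_1,\dots,z_p$: $$m(t,u)=\bigvee_{i=1}^k(x_i\wedge x_i')^{\sim}\vee\bigvee_{j=1}^n(y_j\wedge y_j')^{\sim}\vee\bigvee_{h=1}^p(z_h\wedge z_h')^{\sim}\vee t(x_1,\dots,x_k,z_1,\dots,z_p),$$ and $m(u,t)$ is the same expression with the last joinand $t(x_1,\dots,x_k,z_1,\dots,z_p)$ replaced by $u(y_1,\dots,y_n,z_1,\dots,z_p)$.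
   Formalization: "Nonzero arities" is strengthened: no t_i or u_i may be equivalent over BI-lattices to a term without variables (i.e. to 0 or 1). Otherwise the claim fails: adding x∧0 ≈ x∧x' keeps (1) but breaks (2), since F_8 at x = a violates the resulting equation. *)

theory Defs
  imports "HOL-Algebra.Congruence" "HOL-Library.Infinite_Typeclass" "HOL-Library.FuncSet"
begin

record 'a bi_alg = "'a partial_object" +
  bi_meet :: "'a \<Rightarrow> 'a \<Rightarrow> 'a" (infixl \<open>\<sqinter>\<index>\<close> 70)
  bi_join :: "'a \<Rightarrow> 'a \<Rightarrow> 'a" (infixl \<open>\<squnion>\<index>\<close> 65)
  bi_inv :: "'a \<Rightarrow> 'a" (\<open>_\<acute>\<index>\<close> [1000] 1000)
  bi_zero :: 'a (\<open>\<zero>\<index>\<close>)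
  bi_one :: 'a (\<open>\<one>\<index>\<close>)

record 'a bz_alg = "'a bi_alg" +
  bz_brw :: "'a \<Rightarrow> 'a" (\<open>_\<^sup>\<sim>\<index>\<close> [1000] 1000)

definition bi_le :: "('a, 'm) bi_alg_scheme \<Rightarrow> 'a \<Rightarrow> 'a \<Rightarrow> bool" (infix \<open>\<sqsubseteq>\<index>\<close> 50)
  where "x \<sqsubseteq>\<^bsub>L\<^esub> y \<longleftrightarrow> x \<sqinter>\<^bsub>L\<^esub> y = x"

locale bi_lattice =
  fixes L :: "('a, 'm) bi_alg_scheme" (structure)
  assumes meet_closed: "\<lbrakk>x \<in> carrier L; y \<in> carrier L\<rbrakk> \<Longrightarrow> x \<sqinter> y \<in> carrier L"
    and join_closed: "\<lbrakk>x \<in> carrier L; y \<in> carrier L\<rbrakk> \<Longrightarrow> x \<squnion> y \<in> carrier L"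
    and inv_closed: "x \<in> carrier L \<Longrightarrow> x\<acute> \<in> carrier L"
    and zero_closed: "\<zero> \<in> carrier L"
    and one_closed: "\<one> \<in> carrier L"
    and meet_comm: "\<lbrakk>x \<in> carrier L; y \<in> carrier L\<rbrakk> \<Longrightarrow> x \<sqinter> y = y \<sqinter> x"
    and join_comm: "\<lbrakk>x \<in> carrier L; y \<in> carrier L\<rbrakk> \<Longrightarrow> x \<squnion> y = y \<squnion> x"
    and meet_assoc: "\<lbrakk>x \<in> carrier L; y \<in> carrier L; z \<in> carrier L\<rbrakk>
          \<Longrightarrow> (x \<sqinter> y) \<sqinter> z = x \<sqinter> (y \<sqinter> z)"
    and join_assoc: "\<lbrakk>x \<in> carrier L; y \<in> carrier L; z \<in> carrier L\<rbrakk>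
          \<Longrightarrow> (x \<squnion> y) \<squnion> z = x \<squnion> (y \<squnion> z)"
    and meet_absorb: "\<lbrakk>x \<in> carrier L; y \<in> carrier L\<rbrakk> \<Longrightarrow> x \<sqinter> (x \<squnion> y) = x"
    and join_absorb: "\<lbrakk>x \<in> carrier L; y \<in> carrier L\<rbrakk> \<Longrightarrow> x \<squnion> (x \<sqinter> y) = x"
    and zero_least: "x \<in> carrier L \<Longrightarrow> \<zero> \<sqsubseteq> x"
    and one_greatest: "x \<in> carrier L \<Longrightarrow> x \<sqsubseteq> \<one>"
    and inv_antitone: "\<lbrakk>x \<in> carrier L; y \<in> carrier L; x \<sqsubseteq> y\<rbrakk> \<Longrightarrow> y\<acute> \<sqsubseteq> x\<acute>"
    and inv_involutive: "x \<in> carrier L \<Longrightarrow> x\<acute>\<acute> = x"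

locale pseudo_kleene = bi_lattice +
  assumes kleene: "\<lbrakk>x \<in> carrier L; y \<in> carrier L\<rbrakk> \<Longrightarrow> x \<sqinter> x\<acute> \<sqsubseteq> y \<squnion> y\<acute>"

locale ortholattice = bi_lattice +
  assumes join_inv: "x \<in> carrier L \<Longrightarrow> x \<squnion> x\<acute> = \<one>"

locale bz_lattice = pseudo_kleene L for L :: "('a, 'm) bz_alg_scheme" (structure) +
  assumes brw_closed: "x \<in> carrier L \<Longrightarrow> x\<^sup>\<sim> \<in> carrier L"
    and brw_antitone: "\<lbrakk>x \<in> carrier L; y \<in> carrier L; x \<sqsubseteq> y\<rbrakk> \<Longrightarrow> y\<^sup>\<sim> \<sqsubseteq> x\<^sup>\<sim>"
    and meet_brw: "x \<in> carrier L \<Longrightarrow> x \<sqinter> x\<^sup>\<sim> = \<zero>"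
    and le_brw_brw: "x \<in> carrier L \<Longrightarrow> x \<sqsubseteq> x\<^sup>\<sim>\<^sup>\<sim>"
    and brw_brw: "x \<in> carrier L \<Longrightarrow> x\<^sup>\<sim>\<^sup>\<sim> = x\<^sup>\<sim>\<acute>"

locale pbz_star_lattice = bz_lattice +
  assumes paraorthomodular:
      "\<lbrakk>x \<in> carrier L; y \<in> carrier L; x \<sqsubseteq> y; x\<acute> \<sqinter> y = \<zero>\<rbrakk> \<Longrightarrow> x = y"
    and star: "x \<in> carrier L \<Longrightarrow> (x \<sqinter> x\<acute>)\<^sup>\<sim> = x\<^sup>\<sim> \<squnion> x\<acute>\<^sup>\<sim>"

datatype (bi_vars: 'v) bi_term =
    BIVar 'v
  | BIZero
  | BIOne
  | BIInv "'v bi_term"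
  | BIMeet "'v bi_term" "'v bi_term"
  | BIJoin "'v bi_term" "'v bi_term"

datatype (bz_vars: 'v) bz_term =
    Var 'v
  | Zero
  | One
  | Inv "'v bz_term"
  | Brw "'v bz_term"
  | Meet "'v bz_term" "'v bz_term"
  | Join "'v bz_term" "'v bz_term"

primrec bi_eval :: "('a, 'm) bi_alg_scheme \<Rightarrow> ('v \<Rightarrow> 'a) \<Rightarrow> 'v bi_term \<Rightarrow> 'a" where
  "bi_eval L e (BIVar x) = e x"
| "bi_eval L e BIZero = \<zero>\<^bsub>L\<^esub>"
| "bi_eval L e BIOne = \<one>\<^bsub>L\<^esub>"
| "bi_eval L e (BIInv t) = (bi_eval L e t)\<acute>\<^bsub>L\<^esub>"
| "bi_eval L e (BIMeet s t) = bi_eval L e s \<sqinter>\<^bsub>L\<^esub> bi_eval L e t"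
| "bi_eval L e (BIJoin s t) = bi_eval L e s \<squnion>\<^bsub>L\<^esub> bi_eval L e t"

primrec bz_eval :: "('a, 'm) bz_alg_scheme \<Rightarrow> ('v \<Rightarrow> 'a) \<Rightarrow> 'v bz_term \<Rightarrow> 'a" where
  "bz_eval L e (Var x) = e x"
| "bz_eval L e Zero = \<zero>\<^bsub>L\<^esub>"
| "bz_eval L e One = \<one>\<^bsub>L\<^esub>"
| "bz_eval L e (Inv t) = (bz_eval L e t)\<acute>\<^bsub>L\<^esub>"
| "bz_eval L e (Brw t) = (bz_eval L e t)\<^sup>\<sim>\<^bsub>L\<^esub>"
| "bz_eval L e (Meet s t) = bz_eval L e s \<sqinter>\<^bsub>L\<^esub> bz_eval L e t"
| "bz_eval L e (Join s t) = bz_eval L e s \<squnion>\<^bsub>L\<^esub> bz_eval L e t"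

definition bi_sat :: "('a, 'm) bi_alg_scheme \<Rightarrow> 'v bi_term \<times> 'v bi_term \<Rightarrow> bool" (infix \<open>\<Turnstile>\<^sub>B\<^sub>I\<close> 50)
  where "L \<Turnstile>\<^sub>B\<^sub>I p \<longleftrightarrow>
    (\<forall>e. (\<forall>x. e x \<in> carrier L) \<longrightarrow> bi_eval L e (fst p) = bi_eval L e (snd p))"

definition bz_sat :: "('a, 'm) bz_alg_scheme \<Rightarrow> 'v bz_term \<times> 'v bz_term \<Rightarrow> bool" (infix \<open>\<Turnstile>\<^sub>B\<^sub>Z\<close> 50)
  where "L \<Turnstile>\<^sub>B\<^sub>Z p \<longleftrightarrow>
    (\<forall>e. (\<forall>x. e x \<in> carrier L) \<longrightarrow> bz_eval L e (fst p) = bz_eval L e (snd p))"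

primrec bz_of_bi :: "'v bi_term \<Rightarrow> 'v bz_term" where
  "bz_of_bi (BIVar x) = Var x"
| "bz_of_bi BIZero = Zero"
| "bz_of_bi BIOne = One"
| "bz_of_bi (BIInv t) = Inv (bz_of_bi t)"
| "bz_of_bi (BIMeet s t) = Meet (bz_of_bi s) (bz_of_bi t)"
| "bz_of_bi (BIJoin s t) = Join (bz_of_bi s) (bz_of_bi t)"

abbreviation Diamond :: "'v bz_term \<Rightarrow> 'v bz_term" where
  "Diamond t \<equiv> Brw (Brw t)"

definition brw_kleene :: "'v bz_term \<Rightarrow> 'v bz_term" where
  "brw_kleene s = Brw (Meet s (Inv s))"

definition J0 :: "nat bz_term \<times> nat bz_term" where
  "J0 = (let x = Var 0; y = Var 1 in
     (Join (Meet x (Brw y)) (Meet x (Diamond y)), x))"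

definition D2OL_join :: "nat bz_term \<times> nat bz_term" where
  "D2OL_join = (let x = Var 0; y = Var 1 in
     (Join (Join (Join (brw_kleene x) (brw_kleene y)) x) (Inv x),
      Join (Join (Join (brw_kleene x) (brw_kleene y)) y) (Inv y)))"

text \<open>\<open>m_with t u s\<close> joins the terms \<open>(v \<and> v')\<^sup>\<sim>\<close>, where \<open>v\<close> runs first through the variables
  occurring in \<open>t\<close> only, then through those occurring in \<open>u\<close> only, then through the common ones,
  and puts \<open>s\<close> as the last joinand. Thus \<open>m(t, u)\<close> is \<open>m_with t u t\<close>, and \<open>m(u, t)\<close>, which keeps
  the same joinands apart from the last one, is \<open>m_with t u u\<close>.\<close>

definition m_with :: "nat bi_term \<Rightarrow> nat bi_term \<Rightarrow> nat bi_term \<Rightarrow> nat bz_term" where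
  "m_with t u s =
     foldr (\<lambda>v r. Join (brw_kleene (Var v)) r)
       (sorted_list_of_set (bi_vars t - bi_vars u) @
        sorted_list_of_set (bi_vars u - bi_vars t) @
        sorted_list_of_set (bi_vars t \<inter> bi_vars u))
       (bz_of_bi s)"

definition m_equation :: "nat bi_term \<Rightarrow> nat bi_term \<Rightarrow> nat bz_term \<times> nat bz_term" where
  "m_equation t u = (m_with t u t, m_with t u u)"

definition bi_power :: "('a, 'm) bi_alg_scheme \<Rightarrow> 'i set \<Rightarrow> ('i \<Rightarrow> 'a) bi_alg" where
  "bi_power A X =
    \<lparr>carrier = X \<rightarrow>\<^sub>E carrier A,
     bi_meet = (\<lambda>f g. \<lambda>i\<in>X. f i \<sqinter>\<^bsub>A\<^esub> g i),
     bi_join = (\<lambda>f g. \<lambda>i\<in>X. f i \<squnion>\<^bsub>A\<^esub> g i),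
     bi_inv = (\<lambda>f. \<lambda>i\<in>X. (f i)\<acute>\<^bsub>A\<^esub>),
     bi_zero = (\<lambda>i\<in>X. \<zero>\<^bsub>A\<^esub>),
     bi_one = (\<lambda>i\<in>X. \<one>\<^bsub>A\<^esub>)\<rparr>"

definition bz_power :: "('a, 'm) bz_alg_scheme \<Rightarrow> 'i set \<Rightarrow> ('i \<Rightarrow> 'a) bz_alg" where
  "bz_power A X =
    \<lparr>carrier = X \<rightarrow>\<^sub>E carrier A,
     bi_meet = (\<lambda>f g. \<lambda>i\<in>X. f i \<sqinter>\<^bsub>A\<^esub> g i),
     bi_join = (\<lambda>f g. \<lambda>i\<in>X. f i \<squnion>\<^bsub>A\<^esub> g i),
     bi_inv = (\<lambda>f. \<lambda>i\<in>X. (f i)\<acute>\<^bsub>A\<^esub>),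
     bi_zero = (\<lambda>i\<in>X. \<zero>\<^bsub>A\<^esub>),
     bi_one = (\<lambda>i\<in>X. \<one>\<^bsub>A\<^esub>),
     bz_brw = (\<lambda>f. \<lambda>i\<in>X. (f i)\<^sup>\<sim>\<^bsub>A\<^esub>)\<rparr>"

definition bi_subuniverse :: "'a set \<Rightarrow> ('a, 'm) bi_alg_scheme \<Rightarrow> bool" where
  "bi_subuniverse S A \<longleftrightarrow>
     S \<subseteq> carrier A \<and> \<zero>\<^bsub>A\<^esub> \<in> S \<and> \<one>\<^bsub>A\<^esub> \<in> S \<and> (\<forall>x\<in>S. x\<acute>\<^bsub>A\<^esub> \<in> S) \<and>
     (\<forall>x\<in>S. \<forall>y\<in>S. x \<sqinter>\<^bsub>A\<^esub> y \<in> S \<and> x \<squnion>\<^bsub>A\<^esub> y \<in> S)"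

definition bz_subuniverse :: "'a set \<Rightarrow> ('a, 'm) bz_alg_scheme \<Rightarrow> bool" where
  "bz_subuniverse S A \<longleftrightarrow> bi_subuniverse S A \<and> (\<forall>x\<in>S. x\<^sup>\<sim>\<^bsub>A\<^esub> \<in> S)"

definition bi_hom :: "('a, 'm) bi_alg_scheme \<Rightarrow> ('b, 'n) bi_alg_scheme \<Rightarrow> ('a \<Rightarrow> 'b) set" where
  "bi_hom A B = {h \<in> carrier A \<rightarrow> carrier B.
     h \<zero>\<^bsub>A\<^esub> = \<zero>\<^bsub>B\<^esub> \<and> h \<one>\<^bsub>A\<^esub> = \<one>\<^bsub>B\<^esub> \<and>
     (\<forall>x\<in>carrier A. h (x\<acute>\<^bsub>A\<^esub>) = (h x)\<acute>\<^bsub>B\<^esub>) \<and>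
     (\<forall>x\<in>carrier A. \<forall>y\<in>carrier A.
        h (x \<sqinter>\<^bsub>A\<^esub> y) = h x \<sqinter>\<^bsub>B\<^esub> h y \<and> h (x \<squnion>\<^bsub>A\<^esub> y) = h x \<squnion>\<^bsub>B\<^esub> h y)}"

definition bz_hom :: "('a, 'm) bz_alg_scheme \<Rightarrow> ('b, 'n) bz_alg_scheme \<Rightarrow> ('a \<Rightarrow> 'b) set" where
  "bz_hom A B = {h \<in> bi_hom A B. \<forall>x\<in>carrier A. h (x\<^sup>\<sim>\<^bsub>A\<^esub>) = (h x)\<^sup>\<sim>\<^bsub>B\<^esub>}"

text \<open>The variety generated by \<open>A\<close> is HSP(\<open>A\<close>), the class of all homomorphic images of
  subalgebras of powers of \<open>A\<close>; here it is restricted to algebras whose elements come from a type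
  \<open>'b\<close>. The type \<open>'b \<Rightarrow> 'a\<close> of exponents is no restriction: by the lemmas \<open>bi_varietyI\<close> and
  \<open>bz_varietyI\<close> below, exponents from any other type produce no further algebras.\<close>

definition bi_variety :: "'a bi_alg \<Rightarrow> 'b bi_alg set" where
  "bi_variety A = {L. \<exists>(X :: ('b \<Rightarrow> 'a) set) S h.
     bi_subuniverse S (bi_power A X) \<and>
     h \<in> bi_hom (bi_power A X\<lparr>carrier := S\<rparr>) L \<and> h ` S = carrier L}"

definition bz_variety :: "'a bz_alg \<Rightarrow> 'b bz_alg set" where
  "bz_variety A = {L. \<exists>(X :: ('b \<Rightarrow> 'a) set) S h.
     bz_subuniverse S (bz_power A X) \<and>
     h \<in> bz_hom (bz_power A X\<lparr>carrier := S\<rparr>) L \<and> h ` S = carrier L}"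

lemma reindex_image:
  assumes S: "S \<subseteq> X \<rightarrow>\<^sub>E C"
    and h: "h ` S = D"
    and e: "e = (\<lambda>i b. inv_into S h b i)"
  shows "(\<lambda>f. h (\<lambda>i\<in>X. f (e i))) ` {f \<in> e ` X \<rightarrow>\<^sub>E C. (\<lambda>i\<in>X. f (e i)) \<in> S} = D"
proof (intro equalityI subsetI)
  fix b assume b: "b \<in> D"
  define s where "s = inv_into S h b"
  have s: "s \<in> S" "h s = b"
    using b h inv_into_into[of b h S] f_inv_into_f[of b h S] unfolding s_def by auto
  define f where "f = (\<lambda>w\<in>e ` X. w b)"
  have s_eq: "(\<lambda>i\<in>X. f (e i)) = s"
  proof
    fix i show "(\<lambda>i\<in>X. f (e i)) i = s i"
      using PiE_arb[OF subsetD[OF S s(1)], of i]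
      by (cases "i \<in> X") (auto simp: f_def e s_def[symmetric])
  qed
  moreover have "f \<in> e ` X \<rightarrow>\<^sub>E C"
    using PiE_mem[OF subsetD[OF S s(1)]] by (auto simp: f_def e s_def[symmetric])
  ultimately show "b \<in> (\<lambda>f. h (\<lambda>i\<in>X. f (e i))) ` {f \<in> e ` X \<rightarrow>\<^sub>E C. (\<lambda>i\<in>X. f (e i)) \<in> S}"
    using s by (intro image_eqI[where x = f]) auto
qed (use h in auto)

lemma bi_varietyI:
  fixes A :: "'a bi_alg" and L :: "'b bi_alg" and X :: "'i set"
  assumes A: "bi_lattice A"
    and S: "bi_subuniverse S (bi_power A X)"
    and h: "h \<in> bi_hom (bi_power A X\<lparr>carrier := S\<rparr>) L" "h ` S = carrier L"
  shows "L \<in> bi_variety A"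
proof -
  interpret bi_lattice A by (rule A)
  define e where "e = (\<lambda>i b. inv_into S h b i)"
  define P where "P = (\<lambda>f. \<lambda>i\<in>X. f (e i) :: 'a)"
  define S' where "S' = {f \<in> e ` X \<rightarrow>\<^sub>E carrier A. P f \<in> S}"
  have SX: "S \<subseteq> X \<rightarrow>\<^sub>E carrier A"
    using S by (simp add: bi_subuniverse_def bi_power_def)
  have P_ops: "P (\<lambda>w\<in>e ` X. f w \<sqinter>\<^bsub>A\<^esub> g w) = (\<lambda>i\<in>X. P f i \<sqinter>\<^bsub>A\<^esub> P g i)"
    "P (\<lambda>w\<in>e ` X. f w \<squnion>\<^bsub>A\<^esub> g w) = (\<lambda>i\<in>X. P f i \<squnion>\<^bsub>A\<^esub> P g i)"
    "P (\<lambda>w\<in>e ` X. (f w)\<acute>\<^bsub>A\<^esub>) = (\<lambda>i\<in>X. (P f i)\<acute>\<^bsub>A\<^esub>)"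
    "P (\<lambda>w\<in>e ` X. \<zero>\<^bsub>A\<^esub>) = (\<lambda>i\<in>X. \<zero>\<^bsub>A\<^esub>)"
    "P (\<lambda>w\<in>e ` X. \<one>\<^bsub>A\<^esub>) = (\<lambda>i\<in>X. \<one>\<^bsub>A\<^esub>)" for f g
    by (auto simp: P_def fun_eq_iff restrict_def)
  have "bi_subuniverse S' (bi_power A (e ` X))"
    using S unfolding bi_subuniverse_def bi_power_def S'_def
    by (simp add: P_ops PiE_iff zero_closed one_closed meet_closed join_closed inv_closed)
      (auto simp: PiE_iff extensional_def)
  moreover have "(\<lambda>f. h (P f)) \<in> bi_hom (bi_power A (e ` X)\<lparr>carrier := S'\<rparr>) L"
    using h(1) unfolding bi_hom_def bi_power_def S'_def
    by (simp add: P_ops Pi_iff)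
  moreover have "(\<lambda>f. h (P f)) ` S' = carrier L"
    unfolding S'_def P_def by (rule reindex_image[OF SX h(2) e_def])
  ultimately show ?thesis
    unfolding bi_variety_def by blast
qed

lemma bz_varietyI:
  fixes A :: "'a bz_alg" and L :: "'b bz_alg" and X :: "'i set"
  assumes A: "bz_lattice A"
    and S: "bz_subuniverse S (bz_power A X)"
    and h: "h \<in> bz_hom (bz_power A X\<lparr>carrier := S\<rparr>) L" "h ` S = carrier L"
  shows "L \<in> bz_variety A"
proof -
  interpret bz_lattice A by (rule A)
  define e where "e = (\<lambda>i b. inv_into S h b i)"
  define P where "P = (\<lambda>f. \<lambda>i\<in>X. f (e i) :: 'a)"
  define S' where "S' = {f \<in> e ` X \<rightarrow>\<^sub>E carrier A. P f \<in> S}"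
  have SX: "S \<subseteq> X \<rightarrow>\<^sub>E carrier A"
    using S by (simp add: bz_subuniverse_def bi_subuniverse_def bz_power_def)
  have P_ops: "P (\<lambda>w\<in>e ` X. f w \<sqinter>\<^bsub>A\<^esub> g w) = (\<lambda>i\<in>X. P f i \<sqinter>\<^bsub>A\<^esub> P g i)"
    "P (\<lambda>w\<in>e ` X. f w \<squnion>\<^bsub>A\<^esub> g w) = (\<lambda>i\<in>X. P f i \<squnion>\<^bsub>A\<^esub> P g i)"
    "P (\<lambda>w\<in>e ` X. (f w)\<acute>\<^bsub>A\<^esub>) = (\<lambda>i\<in>X. (P f i)\<acute>\<^bsub>A\<^esub>)"
    "P (\<lambda>w\<in>e ` X. (f w)\<^sup>\<sim>\<^bsub>A\<^esub>) = (\<lambda>i\<in>X. (P f i)\<^sup>\<sim>\<^bsub>A\<^esub>)"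
    "P (\<lambda>w\<in>e ` X. \<zero>\<^bsub>A\<^esub>) = (\<lambda>i\<in>X. \<zero>\<^bsub>A\<^esub>)"
    "P (\<lambda>w\<in>e ` X. \<one>\<^bsub>A\<^esub>) = (\<lambda>i\<in>X. \<one>\<^bsub>A\<^esub>)" for f g
    by (auto simp: P_def fun_eq_iff restrict_def)
  have "bz_subuniverse S' (bz_power A (e ` X))"
    using S unfolding bz_subuniverse_def bi_subuniverse_def bz_power_def S'_def
    by (simp add: P_ops PiE_iff zero_closed one_closed meet_closed join_closed inv_closed
        brw_closed) (auto simp: PiE_iff extensional_def)
  moreover have "(\<lambda>f. h (P f)) \<in> bz_hom (bz_power A (e ` X)\<lparr>carrier := S'\<rparr>) L"
    using h(1) unfolding bz_hom_def bi_hom_def bz_power_def S'_def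
    by (simp add: P_ops Pi_iff)
  moreover have "(\<lambda>f. h (P f)) ` S' = carrier L"
    unfolding S'_def P_def by (rule reindex_image[OF SX h(2) e_def])
  ultimately show ?thesis
    unfolding bz_variety_def by blast
qed

datatype b6 = b6_0 | b6_a | b6_b | b6_a' | b6_b' | b6_1

fun b6_le :: "b6 \<Rightarrow> b6 \<Rightarrow> bool" where
  "b6_le b6_0 y = True"
| "b6_le x b6_1 = True"
| "b6_le b6_a b6_b' = True"
| "b6_le b6_b b6_a' = True"
| "b6_le x y = (x = y)"

fun b6_inv :: "b6 \<Rightarrow> b6" where
  "b6_inv b6_0 = b6_1"
| "b6_inv b6_a = b6_a'"
| "b6_inv b6_b = b6_b'"
| "b6_inv b6_a' = b6_a"
| "b6_inv b6_b' = b6_b"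
| "b6_inv b6_1 = b6_0"

definition B6 :: "b6 bi_alg" where
  "B6 =
    \<lparr>carrier = UNIV,
     bi_meet = (\<lambda>x y. if b6_le x y then x else if b6_le y x then y else b6_0),
     bi_join = (\<lambda>x y. if b6_le x y then y else if b6_le y x then x else b6_1),
     bi_inv = b6_inv,
     bi_zero = b6_0,
     bi_one = b6_1\<rparr>"

lemma B6_meet_iff: "b6_le z (x \<sqinter>\<^bsub>B6\<^esub> y) \<longleftrightarrow> b6_le z x \<and> b6_le z y"
  by (cases x; cases y; cases z; simp add: B6_def)

lemma B6_join_iff: "b6_le (x \<squnion>\<^bsub>B6\<^esub> y) z \<longleftrightarrow> b6_le x z \<and> b6_le y z"
  by (cases x; cases y; cases z; simp add: B6_def)

datatype 'a d2_ext = Bot | Mid 'a | Top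

fun d2_meet :: "('a \<Rightarrow> 'a \<Rightarrow> 'a) \<Rightarrow> 'a d2_ext \<Rightarrow> 'a d2_ext \<Rightarrow> 'a d2_ext" where
  "d2_meet f Bot y = Bot"
| "d2_meet f x Bot = Bot"
| "d2_meet f Top y = y"
| "d2_meet f x Top = x"
| "d2_meet f (Mid x) (Mid y) = Mid (f x y)"

fun d2_join :: "('a \<Rightarrow> 'a \<Rightarrow> 'a) \<Rightarrow> 'a d2_ext \<Rightarrow> 'a d2_ext \<Rightarrow> 'a d2_ext" where
  "d2_join f Top y = Top"
| "d2_join f x Top = Top"
| "d2_join f Bot y = y"
| "d2_join f x Bot = x"
| "d2_join f (Mid x) (Mid y) = Mid (f x y)"

fun d2_inv :: "('a \<Rightarrow> 'a) \<Rightarrow> 'a d2_ext \<Rightarrow> 'a d2_ext" where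
  "d2_inv f Bot = Top"
| "d2_inv f (Mid x) = Mid (f x)"
| "d2_inv f Top = Bot"

text \<open>The ordinal sum \<open>D\<^sub>2 \<oplus> L \<oplus> D\<^sub>2\<close> with the trivial Brouwer complement.\<close>

definition D2_sum :: "('a, 'm) bi_alg_scheme \<Rightarrow> 'a d2_ext bz_alg" where
  "D2_sum L =
    \<lparr>carrier = {Bot, Top} \<union> Mid ` carrier L,
     bi_meet = d2_meet (bi_meet L),
     bi_join = d2_join (bi_join L),
     bi_inv = d2_inv (bi_inv L),
     bi_zero = Bot,
     bi_one = Top,
     bz_brw = (\<lambda>x. if x = Bot then Top else Bot)\<rparr>"

definition F8 :: "b6 d2_ext bz_alg" where
  "F8 = D2_sum B6"

end

theory Submission
  imports Defs
begin

text \<open>Both conditions compare a variety with the models of a set of axioms, so by Birkhoff's theorem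
(\<open>bi_birkhoff\<close>, \<open>bz_birkhoff\<close>) they are statements about equations. What links the two languages
is the construction \<open>M \<mapsto> D\<^sub>2 \<oplus> M \<oplus> D\<^sub>2\<close>, which sends the benzene ring \<open>B\<^sub>6\<close> to \<open>F\<^sub>8\<close>.

Once it is fixed which variables of a term take the new bounds \<open>Bot\<close> and \<open>Top\<close> of \<open>D\<^sub>2 \<oplus> M \<oplus>
D\<^sub>2\<close> and which range over \<open>M\<close>, the term collapses to \<open>Bot\<close>, to \<open>Top\<close>, or to a BI-term evaluated
in \<open>M\<close>. Thus the equations of \<open>D\<^sub>2 \<oplus> M \<oplus> D\<^sub>2\<close> depend only on those of \<open>M\<close> (\<open>D2_sum_sat_mono\<close>).
Conversely, \<open>(v \<and> v')\<^sup>\<sim>\<close> is \<open>Top\<close> if \<open>v\<close> is a bound and \<open>Bot\<close> if \<open>v\<close> lies in \<open>M\<close>; as a joinand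
it makes an equation trivial except where all its variables range over \<open>M\<close>. Hence \<open>m(t, u) \<approx>
m(u, t)\<close> holds in \<open>D\<^sub>2 \<oplus> M \<oplus> D\<^sub>2\<close> iff \<open>t \<approx> u\<close> holds in \<open>M\<close> (\<open>D2_sum_m_equation_iff\<close>). Here it
matters that neither term is equivalent to a constant, since the bounds of \<open>D\<^sub>2 \<oplus> M \<oplus> D\<^sub>2\<close> are
not those of \<open>M\<close>; in ortholattices constants can always be avoided by \<open>0 = x \<and> x'\<close> and \<open>1 = x \<or>
x'\<close>, so the equations of \<open>M\<close> are in turn determined by those of \<open>D\<^sub>2 \<oplus> M \<oplus> D\<^sub>2\<close>
(\<open>D2_sum_sat_reflect\<close>).

It remains to see that the algebras \<open>D\<^sub>2 \<oplus> M \<oplus> D\<^sub>2\<close> with \<open>M\<close> an ortholattice suffice to decide whether an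
equation holds in a PBZ*-lattice with J0 and D2OL\<open>\<or>\<close> (\<open>sat_by_stalks\<close>). J0 says that the elements
\<open>x\<^sup>\<sim>\<close> are central. They form a Boolean algebra, whose ultrafilters yield quotients that separate
points and in which every \<open>x\<^sup>\<sim>\<close> is \<open>0\<close> or \<open>1\<close> (\<open>stalk_exists\<close>). In such a quotient, \<open>x \<and> x' \<noteq> 0\<close> unless
\<open>x\<close> is a bound, so D2OL\<open>\<or>\<close> forces \<open>x \<or> x'\<close> to be the same element for all \<open>x \<notin> {0, 1}\<close>: what is left
after removing \<open>0\<close> and \<open>1\<close> is either empty or an ortholattice (\<open>trivial_brw_cases\<close>).

With this, if \<open>t\<^sub>i \<approx> u\<^sub>i\<close> axiomatise \<open>V(B\<^sub>6)\<close>, the stalks \<open>D\<^sub>2 \<oplus> M \<oplus> D\<^sub>2\<close> of a model of the second set of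
axioms have \<open>M \<in> V(B\<^sub>6)\<close>, hence satisfy all equations of \<open>F\<^sub>8\<close>. Conversely, an ortholattice \<open>M\<close> with
\<open>t\<^sub>i \<approx> u\<^sub>i\<close> gives a model \<open>D\<^sub>2 \<oplus> M \<oplus> D\<^sub>2\<close> of the second set; if this lies in \<open>V(F\<^sub>8)\<close>, then \<open>M\<close> lies in
\<open>V(B\<^sub>6)\<close>. Since all algebras are drawn from one infinite type \<open>'a\<close>, the algebras \<open>B\<^sub>6\<close>, \<open>F\<^sub>8\<close> and
\<open>D\<^sub>2 \<oplus> M \<oplus> D\<^sub>2\<close> enter as isomorphic copies in \<open>'a\<close>.

That the members of \<open>V(F\<^sub>8)\<close> are paraorthomodular is not automatic for a quasi-identity; in the
presence of J0 it follows from the other axioms, which are equations (\<open>pbz_starI\<close>).\<close>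

section \<open>Homomorphisms and equations\<close>

abbreviation bi_closed :: "('a, 'm) bi_alg_scheme \<Rightarrow> bool" where
  "bi_closed A \<equiv> bi_subuniverse (carrier A) A"

abbreviation bz_closed :: "('a, 'm) bz_alg_scheme \<Rightarrow> bool" where
  "bz_closed A \<equiv> bz_subuniverse (carrier A) A"

lemma (in bi_lattice) bi_closed: "bi_closed L"
  by (simp add: bi_subuniverse_def zero_closed one_closed inv_closed meet_closed join_closed)

lemma (in bz_lattice) bz_closed: "bz_closed L"
  using bi_closed by (simp add: bz_subuniverse_def brw_closed)

lemma bi_eval_closed:
  assumes "bi_closed A" "\<And>x. e x \<in> carrier A"
  shows "bi_eval A e t \<in> carrier A"
  using assms by (induction t) (auto simp: bi_subuniverse_def)

lemma bz_eval_closed: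
  assumes "bz_closed A" "\<And>x. e x \<in> carrier A"
  shows "bz_eval A e t \<in> carrier A"
  using assms by (induction t) (auto simp: bz_subuniverse_def bi_subuniverse_def)

lemma bz_eval_bz_of_bi: "bz_eval A e (bz_of_bi t) = bi_eval A e t"
  by (induction t) auto

lemma bi_eval_cong: "(\<And>x. x \<in> bi_vars t \<Longrightarrow> e x = e' x) \<Longrightarrow> bi_eval A e t = bi_eval A e' t"
  by (induction t) auto

lemma bi_hom_eval:
  assumes A: "bi_closed A" and h: "h \<in> bi_hom A B" and e: "\<And>x. e x \<in> carrier A"
  shows "h (bi_eval A e t) = bi_eval B (\<lambda>x. h (e x)) t"
  using h by (induction t) (auto simp: bi_hom_def bi_eval_closed[OF A] e)

lemma bz_hom_eval:
  assumes A: "bz_closed A" and h: "h \<in> bz_hom A B" and e: "\<And>x. e x \<in> carrier A"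
  shows "h (bz_eval A e t) = bz_eval B (\<lambda>x. h (e x)) t"
  using h by (induction t) (auto simp: bz_hom_def bi_hom_def bz_eval_closed[OF A] e)

lemma bi_sat_embedding:
  fixes p :: "'v bi_term \<times> 'v bi_term"
  assumes "bi_closed A" "h \<in> bi_hom A B" "inj_on h (carrier A)" "B \<Turnstile>\<^sub>B\<^sub>I p"
  shows "A \<Turnstile>\<^sub>B\<^sub>I p"
  unfolding bi_sat_def
proof (intro allI impI)
  fix e :: "'v \<Rightarrow> _" assume e: "\<forall>x. e x \<in> carrier A"
  have "\<forall>x. h (e x) \<in> carrier B"
    using assms(2) e by (auto simp: bi_hom_def)
  then have "bi_eval B (\<lambda>x. h (e x)) (fst p) = bi_eval B (\<lambda>x. h (e x)) (snd p)"
    using assms(4) by (simp add: bi_sat_def)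
  then have "h (bi_eval A e (fst p)) = h (bi_eval A e (snd p))"
    using assms(1,2) e by (simp add: bi_hom_eval)
  then show "bi_eval A e (fst p) = bi_eval A e (snd p)"
    using assms(1,3) e by (auto dest: inj_onD intro: bi_eval_closed)
qed

lemma bz_sat_embedding:
  fixes p :: "'v bz_term \<times> 'v bz_term"
  assumes "bz_closed A" "h \<in> bz_hom A B" "inj_on h (carrier A)" "B \<Turnstile>\<^sub>B\<^sub>Z p"
  shows "A \<Turnstile>\<^sub>B\<^sub>Z p"
  unfolding bz_sat_def
proof (intro allI impI)
  fix e :: "'v \<Rightarrow> _" assume e: "\<forall>x. e x \<in> carrier A"
  have "\<forall>x. h (e x) \<in> carrier B"
    using assms(2) e by (auto simp: bz_hom_def bi_hom_def)
  then have "bz_eval B (\<lambda>x. h (e x)) (fst p) = bz_eval B (\<lambda>x. h (e x)) (snd p)"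
    using assms(4) by (simp add: bz_sat_def)
  then have "h (bz_eval A e (fst p)) = h (bz_eval A e (snd p))"
    using assms(1,2) e by (simp add: bz_hom_eval)
  then show "bz_eval A e (fst p) = bz_eval A e (snd p)"
    using assms(1,3) e by (auto dest: inj_onD intro: bz_eval_closed)
qed

lemma bi_sat_image:
  fixes p :: "'v bi_term \<times> 'v bi_term"
  assumes A: "bi_closed A" and h: "h \<in> bi_hom A B" "h ` carrier A = carrier B" and p: "A \<Turnstile>\<^sub>B\<^sub>I p"
  shows "B \<Turnstile>\<^sub>B\<^sub>I p"
  unfolding bi_sat_def
proof (intro allI impI)
  fix e :: "'v \<Rightarrow> _" assume "\<forall>x. e x \<in> carrier B"
  then have "\<forall>x. \<exists>a\<in>carrier A. h a = e x"
    using h(2) by (metis imageE)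
  then obtain d where d: "\<And>x. d x \<in> carrier A" "\<And>x. h (d x) = e x"
    by metis
  have "bi_eval A d (fst p) = bi_eval A d (snd p)"
    using p d(1) by (simp add: bi_sat_def)
  then show "bi_eval B e (fst p) = bi_eval B e (snd p)"
    using bi_hom_eval[OF A h(1), where e = d and t = "fst p"] bi_hom_eval[OF A h(1), where e = d and t = "snd p"]
    by (simp add: d)
qed

lemma bz_sat_image:
  fixes p :: "'v bz_term \<times> 'v bz_term"
  assumes A: "bz_closed A" and h: "h \<in> bz_hom A B" "h ` carrier A = carrier B" and p: "A \<Turnstile>\<^sub>B\<^sub>Z p"
  shows "B \<Turnstile>\<^sub>B\<^sub>Z p"
  unfolding bz_sat_def
proof (intro allI impI)
  fix e :: "'v \<Rightarrow> _" assume "\<forall>x. e x \<in> carrier B"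
  then have "\<forall>x. \<exists>a\<in>carrier A. h a = e x"
    using h(2) by (metis imageE)
  then obtain d where d: "\<And>x. d x \<in> carrier A" "\<And>x. h (d x) = e x"
    by metis
  have "bz_eval A d (fst p) = bz_eval A d (snd p)"
    using p d(1) by (simp add: bz_sat_def)
  then show "bz_eval B e (fst p) = bz_eval B e (snd p)"
    using bz_hom_eval[OF A h(1), where e = d and t = "fst p"] bz_hom_eval[OF A h(1), where e = d and t = "snd p"]
    by (simp add: d)
qed

lemma bi_closed_image:
  assumes A: "bi_closed A" and h: "h \<in> bi_hom A B" "h ` carrier A = carrier B"
  shows "bi_closed B"
  unfolding bi_subuniverse_def h(2)[symmetric] ball_simps
proof (intro conjI ballI)
  show "\<zero>\<^bsub>B\<^esub> \<in> h ` carrier A" "\<one>\<^bsub>B\<^esub> \<in> h ` carrier A"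
    using A h(1) by (auto simp: bi_subuniverse_def bi_hom_def image_iff dest: sym)
  fix x assume x: "x \<in> carrier A"
  have "h (x\<acute>\<^bsub>A\<^esub>) \<in> h ` carrier A"
    using A x by (simp add: bi_subuniverse_def)
  then show "(h x)\<acute>\<^bsub>B\<^esub> \<in> h ` carrier A"
    using h(1) x by (simp add: bi_hom_def)
  fix y assume y: "y \<in> carrier A"
  have "h (x \<sqinter>\<^bsub>A\<^esub> y) \<in> h ` carrier A" "h (x \<squnion>\<^bsub>A\<^esub> y) \<in> h ` carrier A"
    using A x y by (simp_all add: bi_subuniverse_def)
  then show "h x \<sqinter>\<^bsub>B\<^esub> h y \<in> h ` carrier A" "h x \<squnion>\<^bsub>B\<^esub> h y \<in> h ` carrier A"
    using h(1) x y by (simp_all add: bi_hom_def)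
qed simp

lemma bz_closed_image:
  assumes A: "bz_closed A" and h: "h \<in> bz_hom A B" "h ` carrier A = carrier B"
  shows "bz_closed B"
  unfolding bz_subuniverse_def
proof
  have "h \<in> bi_hom A B" using h(1) by (simp add: bz_hom_def)
  then show "bi_closed B"
    using A h(2) by (intro bi_closed_image[of A h B]) (auto simp: bz_subuniverse_def)
  have "h (x\<^sup>\<sim>\<^bsub>A\<^esub>) \<in> carrier B" if "x \<in> carrier A" for x
    using A h that by (auto simp: bz_subuniverse_def)
  then show "\<forall>x\<in>carrier B. x\<^sup>\<sim>\<^bsub>B\<^esub> \<in> carrier B"
    using h(1) by (simp add: bz_hom_def flip: h(2)) 
qed

section \<open>Birkhoff's theorem\<close>

lemma bi_eval_power:
  assumes "i \<in> X"
  shows "bi_eval (bi_power A X\<lparr>carrier := S\<rparr>) e t i = bi_eval A (\<lambda>x. e x i) t"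
  using assms by (induction t) (auto simp: bi_power_def)

lemma bz_eval_power:
  assumes "i \<in> X"
  shows "bz_eval (bz_power A X\<lparr>carrier := S\<rparr>) e t i = bz_eval A (\<lambda>x. e x i) t"
  using assms by (induction t) (auto simp: bz_power_def)

lemma bi_variety_dest:
  fixes A :: "'a bi_alg" and L :: "'b bi_alg" and p :: "'v bi_term \<times> 'v bi_term"
  assumes L: "L \<in> bi_variety A"
  shows "bi_closed L" and "A \<Turnstile>\<^sub>B\<^sub>I p \<Longrightarrow> L \<Turnstile>\<^sub>B\<^sub>I p"
proof -
  obtain X :: "('b \<Rightarrow> 'a) set" and S h where S: "bi_subuniverse S (bi_power A X)"
    and h: "h \<in> bi_hom (bi_power A X\<lparr>carrier := S\<rparr>) L" "h ` S = carrier L"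
    using L unfolding bi_variety_def by blast
  let ?B = "bi_power A X\<lparr>carrier := S\<rparr>"
  have B: "bi_closed ?B"
    using S by (simp add: bi_subuniverse_def bi_power_def)
  have SX: "S \<subseteq> X \<rightarrow>\<^sub>E carrier A"
    using S by (simp add: bi_subuniverse_def bi_power_def)
  show "bi_closed L"
    using bi_closed_image[OF B h(1)] h(2) by simp
  assume p: "A \<Turnstile>\<^sub>B\<^sub>I p"
  have "?B \<Turnstile>\<^sub>B\<^sub>I p"
    unfolding bi_sat_def
  proof (intro allI impI ext)
    fix e :: "'v \<Rightarrow> _" and i assume e: "\<forall>x. e x \<in> carrier ?B"
    have mem: "bi_eval ?B e q \<in> X \<rightarrow>\<^sub>E carrier A" for q
      using bi_eval_closed[OF B, of e] e SX by auto
    show "bi_eval ?B e (fst p) i = bi_eval ?B e (snd p) i"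
    proof (cases "i \<in> X")
      case True
      then have "\<forall>x. e x i \<in> carrier A" using e SX by (auto simp: PiE_iff subset_iff)
      then show ?thesis using p True by (simp add: bi_eval_power bi_sat_def)
    next
      case False
      then show ?thesis using PiE_arb[OF mem] by simp
    qed
  qed
  then show "L \<Turnstile>\<^sub>B\<^sub>I p" by (rule bi_sat_image[OF B h(1), rotated]) (simp add: h(2))
qed

lemma bz_variety_dest:
  fixes A :: "'a bz_alg" and L :: "'b bz_alg" and p :: "'v bz_term \<times> 'v bz_term"
  assumes L: "L \<in> bz_variety A"
  shows "bz_closed L" and "A \<Turnstile>\<^sub>B\<^sub>Z p \<Longrightarrow> L \<Turnstile>\<^sub>B\<^sub>Z p"
proof -
  obtain X :: "('b \<Rightarrow> 'a) set" and S h where S: "bz_subuniverse S (bz_power A X)"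
    and h: "h \<in> bz_hom (bz_power A X\<lparr>carrier := S\<rparr>) L" "h ` S = carrier L"
    using L unfolding bz_variety_def by blast
  let ?B = "bz_power A X\<lparr>carrier := S\<rparr>"
  have B: "bz_closed ?B"
    using S by (simp add: bz_subuniverse_def bi_subuniverse_def bz_power_def)
  have SX: "S \<subseteq> X \<rightarrow>\<^sub>E carrier A"
    using S by (simp add: bz_subuniverse_def bi_subuniverse_def bz_power_def)
  show "bz_closed L"
    using bz_closed_image[OF B h(1)] h(2) by simp
  assume p: "A \<Turnstile>\<^sub>B\<^sub>Z p"
  have "?B \<Turnstile>\<^sub>B\<^sub>Z p"
    unfolding bz_sat_def
  proof (intro allI impI ext)
    fix e :: "'v \<Rightarrow> _" and i assume e: "\<forall>x. e x \<in> carrier ?B"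
    have mem: "bz_eval ?B e q \<in> X \<rightarrow>\<^sub>E carrier A" for q
      using bz_eval_closed[OF B, of e] e SX by auto
    show "bz_eval ?B e (fst p) i = bz_eval ?B e (snd p) i"
    proof (cases "i \<in> X")
      case True
      then have "\<forall>x. e x i \<in> carrier A" using e SX by (auto simp: PiE_iff subset_iff)
      then show ?thesis using p True by (simp add: bz_eval_power bz_sat_def)
    next
      case False
      then show ?thesis using PiE_arb[OF mem] by simp
    qed
  qed
  then show "L \<Turnstile>\<^sub>B\<^sub>Z p" by (rule bz_sat_image[OF B h(1), rotated]) (simp add: h(2))
qed

text \<open>The free algebra is realised inside the power of \<open>A\<close> indexed by all valuations in \<open>A\<close>: its elements
are the term functions, with the elements of \<open>L\<close> as variables, and a term function is sent to the
value of the term in \<open>L\<close>. This is well defined because two terms with the same term function form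
an equation of \<open>A\<close>. Valuations have type \<open>'b \<Rightarrow> 'a\<close>, just like the exponents in \<open>bi_variety\<close>.\<close>

lemma bi_birkhoff:
  fixes A :: "'a bi_alg" and L :: "'b bi_alg"
  assumes A: "bi_closed A" and L: "bi_closed L"
    and sat: "\<And>p :: 'b bi_term \<times> 'b bi_term. A \<Turnstile>\<^sub>B\<^sub>I p \<Longrightarrow> L \<Turnstile>\<^sub>B\<^sub>I p"
  shows "L \<in> bi_variety A"
proof -
  define X where "X = {e :: 'b \<Rightarrow> 'a. \<forall>x. e x \<in> carrier A}"
  \<comment> \<open>Every element of the type \<open>'b\<close> is a variable; those outside \<open>L\<close> need some value in \<open>L\<close> as well.\<close>
  define v where "v x = (if x \<in> carrier L then x else \<zero>\<^bsub>L\<^esub>)" for x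
  define F where "F t = (\<lambda>e\<in>X. bi_eval A e t)" for t
  define h where "h f = bi_eval L v (SOME t. f = F t)" for f
  have v: "v x \<in> carrier L" for x
    using L by (simp add: v_def bi_subuniverse_def)
  have hF: "h (F t) = bi_eval L v t" for t
  proof -
    define s where "s = (SOME s. F t = F s)"
    have "F t = F s" unfolding s_def by (rule someI[where x = t]) simp
    then have "F t e = F s e" for e by simp
    then have "A \<Turnstile>\<^sub>B\<^sub>I (s, t)"
      by (simp add: bi_sat_def F_def X_def restrict_def) metis
    then have "bi_eval L v s = bi_eval L v t"
      using sat[of "(s, t)"] v by (auto simp: bi_sat_def)
    then show ?thesis by (simp add: h_def s_def)
  qed
  have ops: "\<zero>\<^bsub>bi_power A X\<^esub> = F BIZero" "\<one>\<^bsub>bi_power A X\<^esub> = F BIOne"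
    "(F s)\<acute>\<^bsub>bi_power A X\<^esub> = F (BIInv s)"
    "F s \<sqinter>\<^bsub>bi_power A X\<^esub> F t = F (BIMeet s t)" "F s \<squnion>\<^bsub>bi_power A X\<^esub> F t = F (BIJoin s t)" for s t
    by (auto simp: F_def bi_power_def fun_eq_iff)
  have "F t \<in> carrier (bi_power A X)" for t
    using A by (auto simp: F_def bi_power_def X_def bi_eval_closed)
  then have "bi_subuniverse (range F) (bi_power A X)"
    unfolding bi_subuniverse_def using ops by auto
  moreover have "h \<in> bi_hom (bi_power A X\<lparr>carrier := range F\<rparr>) L"
    using bi_eval_closed[of L v] L v by (auto simp: bi_hom_def ops hF)
  moreover have "h ` range F = carrier L"
  proof (intro equalityI subsetI)
    fix x assume "x \<in> carrier L"
    then have "x = h (F (BIVar x))"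
      by (simp add: hF v_def)
    then show "x \<in> h ` range F" by blast
  qed (auto simp: hF intro: bi_eval_closed[of L v, OF L v])
  ultimately show ?thesis unfolding bi_variety_def by blast
qed

lemma bz_birkhoff:
  fixes A :: "'a bz_alg" and L :: "'b bz_alg"
  assumes A: "bz_closed A" and L: "bz_closed L"
    and sat: "\<And>p :: 'b bz_term \<times> 'b bz_term. A \<Turnstile>\<^sub>B\<^sub>Z p \<Longrightarrow> L \<Turnstile>\<^sub>B\<^sub>Z p"
  shows "L \<in> bz_variety A"
proof -
  define X where "X = {e :: 'b \<Rightarrow> 'a. \<forall>x. e x \<in> carrier A}"
  define v where "v x = (if x \<in> carrier L then x else \<zero>\<^bsub>L\<^esub>)" for x
  define F where "F t = (\<lambda>e\<in>X. bz_eval A e t)" for t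
  define h where "h f = bz_eval L v (SOME t. f = F t)" for f
  have v: "v x \<in> carrier L" for x
    using L by (simp add: v_def bz_subuniverse_def bi_subuniverse_def)
  have hF: "h (F t) = bz_eval L v t" for t
  proof -
    define s where "s = (SOME s. F t = F s)"
    have "F t = F s" unfolding s_def by (rule someI[where x = t]) simp
    then have "F t e = F s e" for e by simp
    then have "A \<Turnstile>\<^sub>B\<^sub>Z (s, t)"
      by (simp add: bz_sat_def F_def X_def restrict_def) metis
    then have "bz_eval L v s = bz_eval L v t"
      using sat[of "(s, t)"] v by (auto simp: bz_sat_def)
    then show ?thesis by (simp add: h_def s_def)
  qed
  have ops: "\<zero>\<^bsub>bz_power A X\<^esub> = F Zero" "\<one>\<^bsub>bz_power A X\<^esub> = F One"
    "(F s)\<acute>\<^bsub>bz_power A X\<^esub> = F (Inv s)" "(F s)\<^sup>\<sim>\<^bsub>bz_power A X\<^esub> = F (Brw s)"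
    "F s \<sqinter>\<^bsub>bz_power A X\<^esub> F t = F (Meet s t)" "F s \<squnion>\<^bsub>bz_power A X\<^esub> F t = F (Join s t)" for s t
    by (auto simp: F_def bz_power_def fun_eq_iff)
  have "F t \<in> carrier (bz_power A X)" for t
    using A by (auto simp: F_def bz_power_def X_def bz_eval_closed)
  then have "bz_subuniverse (range F) (bz_power A X)"
    unfolding bz_subuniverse_def bi_subuniverse_def using ops by auto
  moreover have "h \<in> bz_hom (bz_power A X\<lparr>carrier := range F\<rparr>) L"
    using bz_eval_closed[of L v] L v by (auto simp: bz_hom_def bi_hom_def ops hF)
  moreover have "h ` range F = carrier L"
  proof (intro equalityI subsetI)
    fix x assume "x \<in> carrier L"
    then have "x = h (F (Var x))"
      by (simp add: hF v_def)
    then show "x \<in> h ` range F" by blast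
  qed (auto simp: hF intro: bz_eval_closed[of L v, OF L v])
  ultimately show ?thesis unfolding bz_variety_def by blast
qed

section \<open>Varieties defined by the axioms\<close>

text \<open>The axioms use at most three variables; \<open>val3\<close> instantiates equations in the variables 0, 1, 2.\<close>

definition val3 :: "'a \<Rightarrow> 'a \<Rightarrow> 'a \<Rightarrow> nat \<Rightarrow> 'a" where
  "val3 x y z n = (if n = 0 then x else if n = 1 then y else z)"

lemma bi_sat_val3:
  "\<lbrakk>L \<Turnstile>\<^sub>B\<^sub>I (s, t); x \<in> carrier L; y \<in> carrier L; z \<in> carrier L\<rbrakk>
    \<Longrightarrow> bi_eval L (val3 x y z) s = bi_eval L (val3 x y z) t"
  by (simp add: bi_sat_def val3_def)

lemma bz_sat_val3:
  "\<lbrakk>L \<Turnstile>\<^sub>B\<^sub>Z (s, t); x \<in> carrier L; y \<in> carrier L; z \<in> carrier L\<rbrakk>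
    \<Longrightarrow> bz_eval L (val3 x y z) s = bz_eval L (val3 x y z) t"
  by (simp add: bz_sat_def val3_def)

context bi_lattice
begin

lemma meet_idem: "x \<in> carrier L \<Longrightarrow> x \<sqinter> x = x"
  by (metis join_absorb meet_absorb meet_closed)

lemma join_idem: "x \<in> carrier L \<Longrightarrow> x \<squnion> x = x"
  by (metis join_absorb meet_absorb join_closed)

lemma le_refl: "x \<in> carrier L \<Longrightarrow> x \<sqsubseteq> x"
  by (simp add: bi_le_def meet_idem)

lemma le_trans:
  "\<lbrakk>x \<in> carrier L; y \<in> carrier L; z \<in> carrier L; x \<sqsubseteq> y; y \<sqsubseteq> z\<rbrakk> \<Longrightarrow> x \<sqsubseteq> z"
  unfolding bi_le_def by (metis meet_assoc)

lemma le_antisym: "\<lbrakk>x \<in> carrier L; y \<in> carrier L; x \<sqsubseteq> y; y \<sqsubseteq> x\<rbrakk> \<Longrightarrow> x = y"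
  unfolding bi_le_def by (metis meet_comm)

lemma meet_le1: "\<lbrakk>x \<in> carrier L; y \<in> carrier L\<rbrakk> \<Longrightarrow> x \<sqinter> y \<sqsubseteq> x"
  unfolding bi_le_def by (metis meet_assoc meet_comm meet_idem meet_closed)

lemma meet_le2: "\<lbrakk>x \<in> carrier L; y \<in> carrier L\<rbrakk> \<Longrightarrow> x \<sqinter> y \<sqsubseteq> y"
  unfolding bi_le_def by (metis meet_assoc meet_idem)

lemma meet_greatest:
  "\<lbrakk>x \<in> carrier L; y \<in> carrier L; z \<in> carrier L; z \<sqsubseteq> x; z \<sqsubseteq> y\<rbrakk> \<Longrightarrow> z \<sqsubseteq> x \<sqinter> y"
  unfolding bi_le_def by (metis meet_assoc)

lemma meet_le_trans1:
  "\<lbrakk>x \<in> carrier L; y \<in> carrier L; z \<in> carrier L; x \<sqsubseteq> z\<rbrakk> \<Longrightarrow> x \<sqinter> y \<sqsubseteq> z"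
  using le_trans[OF _ _ _ meet_le1] meet_closed by blast

lemma meet_le_trans2:
  "\<lbrakk>x \<in> carrier L; y \<in> carrier L; z \<in> carrier L; y \<sqsubseteq> z\<rbrakk> \<Longrightarrow> x \<sqinter> y \<sqsubseteq> z"
  using le_trans[OF _ _ _ meet_le2] meet_closed by blast

lemma le_iff_join: "\<lbrakk>x \<in> carrier L; y \<in> carrier L\<rbrakk> \<Longrightarrow> x \<sqsubseteq> y \<longleftrightarrow> x \<squnion> y = y"
  unfolding bi_le_def by (metis join_absorb meet_absorb join_comm meet_comm)

lemma join_ge1: "\<lbrakk>x \<in> carrier L; y \<in> carrier L\<rbrakk> \<Longrightarrow> x \<sqsubseteq> x \<squnion> y"
  by (simp add: bi_le_def meet_absorb)

lemma join_ge2: "\<lbrakk>x \<in> carrier L; y \<in> carrier L\<rbrakk> \<Longrightarrow> y \<sqsubseteq> x \<squnion> y"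
  by (metis join_comm join_ge1)

lemma le_join_trans1:
  "\<lbrakk>x \<in> carrier L; y \<in> carrier L; z \<in> carrier L; z \<sqsubseteq> x\<rbrakk> \<Longrightarrow> z \<sqsubseteq> x \<squnion> y"
  using le_trans[OF _ _ _ _ join_ge1] join_closed by blast

lemma le_join_trans2:
  "\<lbrakk>x \<in> carrier L; y \<in> carrier L; z \<in> carrier L; z \<sqsubseteq> y\<rbrakk> \<Longrightarrow> z \<sqsubseteq> x \<squnion> y"
  using le_trans[OF _ _ _ _ join_ge2] join_closed by blast

lemma join_least:
  "\<lbrakk>x \<in> carrier L; y \<in> carrier L; z \<in> carrier L; x \<sqsubseteq> z; y \<sqsubseteq> z\<rbrakk> \<Longrightarrow> x \<squnion> y \<sqsubseteq> z"
  by (metis le_iff_join join_assoc join_closed)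

lemma join_inv_eq: "\<lbrakk>x \<in> carrier L; y \<in> carrier L\<rbrakk> \<Longrightarrow> (x \<squnion> y)\<acute> = x\<acute> \<sqinter> y\<acute>"
proof (rule le_antisym)
  assume xy: "x \<in> carrier L" "y \<in> carrier L"
  note cl = xy inv_closed join_closed meet_closed
  show "(x \<squnion> y)\<acute> \<sqsubseteq> x\<acute> \<sqinter> y\<acute>"
    by (intro meet_greatest inv_antitone join_ge1 join_ge2 cl)
  have "(x\<acute> \<sqinter> y\<acute>)\<acute>\<acute> \<sqsubseteq> (x \<squnion> y)\<acute>"
  proof (intro inv_antitone cl join_least)
    show "x \<sqsubseteq> (x\<acute> \<sqinter> y\<acute>)\<acute>"
      using inv_antitone[OF _ _ meet_le1, of "x\<acute>" "y\<acute>"] by (simp add: inv_involutive cl)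
    show "y \<sqsubseteq> (x\<acute> \<sqinter> y\<acute>)\<acute>"
      using inv_antitone[OF _ _ meet_le2, of "x\<acute>" "y\<acute>"] by (simp add: inv_involutive cl)
  qed
  then show "x\<acute> \<sqinter> y\<acute> \<sqsubseteq> (x \<squnion> y)\<acute>" by (simp add: inv_involutive cl)
qed (simp_all add: inv_closed join_closed meet_closed)

lemma meet_inv_eq: "\<lbrakk>x \<in> carrier L; y \<in> carrier L\<rbrakk> \<Longrightarrow> (x \<sqinter> y)\<acute> = x\<acute> \<squnion> y\<acute>"
  by (metis join_inv_eq inv_closed inv_involutive join_closed)

lemma zero_inv: "\<zero>\<acute> = \<one>"
  by (metis zero_closed one_closed inv_closed inv_involutive inv_antitone zero_least
      one_greatest le_antisym)

lemma one_inv: "\<one>\<acute> = \<zero>"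
  by (metis zero_inv inv_involutive zero_closed)

lemma bounds:
  assumes "x \<in> carrier L"
  shows "\<zero> \<sqinter> x = \<zero>" "x \<sqinter> \<zero> = \<zero>" "\<one> \<sqinter> x = x" "x \<sqinter> \<one> = x"
    "\<zero> \<squnion> x = x" "x \<squnion> \<zero> = x" "\<one> \<squnion> x = \<one>" "x \<squnion> \<one> = \<one>"
  using zero_least[OF assms] one_greatest[OF assms] le_iff_join[of \<zero> x] le_iff_join[of x \<one>]
    meet_comm[of x \<zero>] meet_comm[of x \<one>] join_comm[of x \<zero>] join_comm[of x \<one>]
  by (simp_all add: bi_le_def assms zero_closed one_closed)

end

lemma (in ortholattice) meet_inv: "x \<in> carrier L \<Longrightarrow> x \<sqinter> x\<acute> = \<zero>"
  by (metis join_inv join_inv_eq inv_closed inv_involutive one_inv meet_comm)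

text \<open>The only axiom that is not an equation, that the involution reverses the order, is equivalent to
\<open>x' = x' \<and> (x \<and> y)'\<close>. The Brouwer complement is treated in the same way below.\<close>

lemma bi_lattice_equational:
  fixes B :: "('b, 'n) bi_alg_scheme"
  assumes A: "bi_lattice A" and B: "bi_closed B"
    and sat: "\<And>p :: nat bi_term \<times> nat bi_term. A \<Turnstile>\<^sub>B\<^sub>I p \<Longrightarrow> B \<Turnstile>\<^sub>B\<^sub>I p"
  shows "bi_lattice B"
proof -
  interpret A: bi_lattice A by (rule A)
  note cl = A.zero_closed A.one_closed A.meet_closed A.join_closed A.inv_closed
  let ?x = "BIVar (0::nat)" and ?y = "BIVar (1::nat)" and ?z = "BIVar (2::nat)"
  note b = bi_sat_val3[OF sat]
  note [simp] = val3_def bi_sat_def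
  have anti: "x\<acute>\<^bsub>A\<^esub> = x\<acute>\<^bsub>A\<^esub> \<sqinter>\<^bsub>A\<^esub> (x \<sqinter>\<^bsub>A\<^esub> y)\<acute>\<^bsub>A\<^esub>" if "x \<in> carrier A" "y \<in> carrier A" for x y
    using A.inv_antitone[OF _ _ A.meet_le1, of x y] that by (simp add: cl bi_le_def)
  show ?thesis
  proof
    fix x y z assume x: "x \<in> carrier B" and y: "y \<in> carrier B" and z: "z \<in> carrier B"
    note xyz = x y z
    show "x \<sqinter>\<^bsub>B\<^esub> y \<in> carrier B" "x \<squnion>\<^bsub>B\<^esub> y \<in> carrier B" "x\<acute>\<^bsub>B\<^esub> \<in> carrier B"
      using B xyz by (auto simp: bi_subuniverse_def)
    show "x \<sqinter>\<^bsub>B\<^esub> y = y \<sqinter>\<^bsub>B\<^esub> x"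
      using b[of "BIMeet ?x ?y" "BIMeet ?y ?x", OF _ xyz] by (simp add: A.meet_comm)
    show "x \<squnion>\<^bsub>B\<^esub> y = y \<squnion>\<^bsub>B\<^esub> x"
      using b[of "BIJoin ?x ?y" "BIJoin ?y ?x", OF _ xyz] by (simp add: A.join_comm)
    show "(x \<sqinter>\<^bsub>B\<^esub> y) \<sqinter>\<^bsub>B\<^esub> z = x \<sqinter>\<^bsub>B\<^esub> (y \<sqinter>\<^bsub>B\<^esub> z)"
      using b[of "BIMeet (BIMeet ?x ?y) ?z" "BIMeet ?x (BIMeet ?y ?z)", OF _ xyz]
      by (simp add: A.meet_assoc)
    show "(x \<squnion>\<^bsub>B\<^esub> y) \<squnion>\<^bsub>B\<^esub> z = x \<squnion>\<^bsub>B\<^esub> (y \<squnion>\<^bsub>B\<^esub> z)"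
      using b[of "BIJoin (BIJoin ?x ?y) ?z" "BIJoin ?x (BIJoin ?y ?z)", OF _ xyz]
      by (simp add: A.join_assoc)
    show "x \<sqinter>\<^bsub>B\<^esub> (x \<squnion>\<^bsub>B\<^esub> y) = x"
      using b[of "BIMeet ?x (BIJoin ?x ?y)" ?x, OF _ xyz] by (simp add: A.meet_absorb)
    show "x \<squnion>\<^bsub>B\<^esub> (x \<sqinter>\<^bsub>B\<^esub> y) = x"
      using b[of "BIJoin ?x (BIMeet ?x ?y)" ?x, OF _ xyz] by (simp add: A.join_absorb)
    show "\<zero>\<^bsub>B\<^esub> \<sqsubseteq>\<^bsub>B\<^esub> x"
      using b[of "BIMeet BIZero ?x" BIZero, OF _ xyz] by (simp add: A.bounds bi_le_def)
    show "x \<sqsubseteq>\<^bsub>B\<^esub> \<one>\<^bsub>B\<^esub>"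
      using b[of "BIMeet ?x BIOne" ?x, OF _ xyz] by (simp add: A.bounds bi_le_def)
    show "x\<acute>\<^bsub>B\<^esub>\<acute>\<^bsub>B\<^esub> = x"
      using b[of "BIInv (BIInv ?x)" ?x, OF _ xyz] by (simp add: A.inv_involutive)
    have "y\<acute>\<^bsub>B\<^esub> = y\<acute>\<^bsub>B\<^esub> \<sqinter>\<^bsub>B\<^esub> (y \<sqinter>\<^bsub>B\<^esub> x)\<acute>\<^bsub>B\<^esub>"
      using b[of "BIInv ?y" "BIMeet (BIInv ?y) (BIInv (BIMeet ?y ?x))", OF _ xyz] anti by simp
    moreover have "y \<sqinter>\<^bsub>B\<^esub> x = x \<sqinter>\<^bsub>B\<^esub> y"
      using b[of "BIMeet ?y ?x" "BIMeet ?x ?y", OF _ xyz] by (simp add: A.meet_comm)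
    ultimately show "y\<acute>\<^bsub>B\<^esub> \<sqsubseteq>\<^bsub>B\<^esub> x\<acute>\<^bsub>B\<^esub>" if "x \<sqsubseteq>\<^bsub>B\<^esub> y"
      using that by (simp add: bi_le_def)
  qed (use B in \<open>auto simp: bi_subuniverse_def\<close>)
qed

lemma ortholattice_equational:
  assumes A: "ortholattice A" and B: "bi_closed B"
    and sat: "\<And>p :: nat bi_term \<times> nat bi_term. A \<Turnstile>\<^sub>B\<^sub>I p \<Longrightarrow> B \<Turnstile>\<^sub>B\<^sub>I p"
  shows "ortholattice B"
proof -
  interpret A: ortholattice A by (rule A)
  interpret B: bi_lattice B
    using bi_lattice_equational A.bi_lattice_axioms B sat by blast
  show ?thesis
  proof
    fix x assume x: "x \<in> carrier B"
    show "x \<squnion>\<^bsub>B\<^esub> x\<acute>\<^bsub>B\<^esub> = \<one>\<^bsub>B\<^esub>"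
      using bi_sat_val3[OF sat, of "BIJoin (BIVar 0) (BIInv (BIVar 0))" BIOne, OF _ x x x]
      by (simp add: bi_sat_def val3_def A.join_inv)
  qed
qed

lemma bz_lattice_equational:
  fixes B :: "('b, 'n) bz_alg_scheme"
  assumes A: "bz_lattice A" and B: "bz_closed B"
    and sat: "\<And>p :: nat bz_term \<times> nat bz_term. A \<Turnstile>\<^sub>B\<^sub>Z p \<Longrightarrow> B \<Turnstile>\<^sub>B\<^sub>Z p"
  shows "bz_lattice B"
proof -
  interpret A: bz_lattice A by (rule A)
  note cl = A.zero_closed A.one_closed A.meet_closed A.join_closed A.inv_closed A.brw_closed
  have "B \<Turnstile>\<^sub>B\<^sub>I p" if "A \<Turnstile>\<^sub>B\<^sub>I p" for p :: "nat bi_term \<times> nat bi_term"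
    using sat[of "map_prod bz_of_bi bz_of_bi p"] that
    by (simp add: bi_sat_def bz_sat_def bz_eval_bz_of_bi)
  then interpret B: bi_lattice B
    using bi_lattice_equational[OF A.bi_lattice_axioms, of B] B by (simp add: bz_subuniverse_def)
  let ?x = "Var (0::nat)" and ?y = "Var (1::nat)"
  note b = bz_sat_val3[OF sat]
  note [simp] = val3_def bz_sat_def
  have anti: "x\<^sup>\<sim>\<^bsub>A\<^esub> = x\<^sup>\<sim>\<^bsub>A\<^esub> \<sqinter>\<^bsub>A\<^esub> (x \<sqinter>\<^bsub>A\<^esub> y)\<^sup>\<sim>\<^bsub>A\<^esub>" if "x \<in> carrier A" "y \<in> carrier A" for x y
    using A.brw_antitone[OF _ _ A.meet_le1, of x y] that by (simp add: cl bi_le_def)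
  show ?thesis
  proof
    fix x y assume x: "x \<in> carrier B" and y: "y \<in> carrier B"
    note xyz = x y x
    show "x\<^sup>\<sim>\<^bsub>B\<^esub> \<in> carrier B"
      using B x by (simp add: bz_subuniverse_def)
    show "x \<sqinter>\<^bsub>B\<^esub> x\<acute>\<^bsub>B\<^esub> \<sqsubseteq>\<^bsub>B\<^esub> y \<squnion>\<^bsub>B\<^esub> y\<acute>\<^bsub>B\<^esub>"
      using b[of "Meet (Meet ?x (Inv ?x)) (Join ?y (Inv ?y))" "Meet ?x (Inv ?x)", OF _ xyz]
        A.kleene by (simp add: bi_le_def)
    show "x \<sqinter>\<^bsub>B\<^esub> x\<^sup>\<sim>\<^bsub>B\<^esub> = \<zero>\<^bsub>B\<^esub>"
      using b[of "Meet ?x (Brw ?x)" Zero, OF _ xyz] by (simp add: A.meet_brw)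
    show "x \<sqsubseteq>\<^bsub>B\<^esub> x\<^sup>\<sim>\<^bsub>B\<^esub>\<^sup>\<sim>\<^bsub>B\<^esub>"
      using b[of "Meet ?x (Brw (Brw ?x))" ?x, OF _ xyz] A.le_brw_brw by (simp add: bi_le_def)
    show "x\<^sup>\<sim>\<^bsub>B\<^esub>\<^sup>\<sim>\<^bsub>B\<^esub> = x\<^sup>\<sim>\<^bsub>B\<^esub>\<acute>\<^bsub>B\<^esub>"
      using b[of "Brw (Brw ?x)" "Inv (Brw ?x)", OF _ xyz] by (simp add: A.brw_brw)
    have "y\<^sup>\<sim>\<^bsub>B\<^esub> = y\<^sup>\<sim>\<^bsub>B\<^esub> \<sqinter>\<^bsub>B\<^esub> (y \<sqinter>\<^bsub>B\<^esub> x)\<^sup>\<sim>\<^bsub>B\<^esub>"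
      using b[of "Brw ?y" "Meet (Brw ?y) (Brw (Meet ?y ?x))", OF _ xyz] anti by simp
    then show "y\<^sup>\<sim>\<^bsub>B\<^esub> \<sqsubseteq>\<^bsub>B\<^esub> x\<^sup>\<sim>\<^bsub>B\<^esub>" if "x \<sqsubseteq>\<^bsub>B\<^esub> y"
      using that B.meet_comm[OF x y] by (simp add: bi_le_def)
  qed
qed

section \<open>The construction \<open>D\<^sub>2 \<oplus> L \<oplus> D\<^sub>2\<close>\<close>

lemma d2_meet_simps [simp]:
  "d2_meet f x Bot = Bot" "d2_meet f Top y = y" "d2_meet f x Top = x"
  by ((cases x; simp; fail) | (cases y; simp; fail))+

lemma d2_join_simps [simp]:
  "d2_join f x Top = Top" "d2_join f Bot y = y" "d2_join f x Bot = x"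
  by ((cases x; simp; fail) | (cases y; simp; fail))+

lemma D2_sum_map_hom:
  assumes "f \<in> bi_hom A N"
  shows "map_d2_ext f \<in> bz_hom (D2_sum A) (D2_sum N)"
  using assms by (auto simp: bz_hom_def bi_hom_def D2_sum_def)

lemma D2_sum_closed: "bi_closed A \<Longrightarrow> bz_closed (D2_sum A)"
  by (auto simp: bz_subuniverse_def bi_subuniverse_def D2_sum_def)

text \<open>Terms satisfy no lattice axioms, but \<open>D2_sum\<close> applies to any algebra. Evaluating a term in
\<open>D2_sum term_alg\<close> is a symbolic computation, which the maps induced by \<open>bi_eval N d\<close> specialise to
all \<open>D2_sum N\<close> at once.\<close>

definition term_alg :: "'v bi_term bi_alg" where
  "term_alg = \<lparr>carrier = UNIV, bi_meet = BIMeet, bi_join = BIJoin, bi_inv = BIInv,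
     bi_zero = BIZero, bi_one = BIOne\<rparr>"

lemma term_alg_closed: "bi_closed term_alg"
  by (simp add: bi_subuniverse_def term_alg_def)

lemma bi_eval_hom:
  assumes "bi_closed N" "\<And>v. d v \<in> carrier N"
  shows "bi_eval N d \<in> bi_hom term_alg N"
  using assms by (auto simp: bi_hom_def term_alg_def bi_eval_closed)

lemma D2_sum_eval:
  assumes "bi_closed N" "\<And>v. d v \<in> carrier N"
  shows "bz_eval (D2_sum N) (\<lambda>v. map_d2_ext (bi_eval N d) (g v)) t
    = map_d2_ext (bi_eval N d) (bz_eval (D2_sum term_alg) g t)"
proof -
  have "g v \<in> carrier (D2_sum term_alg)" for v
    by (cases "g v") (auto simp: D2_sum_def term_alg_def)
  then show ?thesis
    using bz_hom_eval[OF D2_sum_closed[OF term_alg_closed]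
        D2_sum_map_hom[OF bi_eval_hom[OF assms]], where e = g and t = t] by simp
qed

text \<open>The element \<open>z\<close> is a dummy value for the two bounds.\<close>

definition mid_part :: "'a \<Rightarrow> 'a d2_ext \<Rightarrow> 'a" where
  "mid_part z x = (case x of Mid a \<Rightarrow> a | _ \<Rightarrow> z)"

lemma mid_part_Mid [simp]: "mid_part z (Mid a) = a"
  by (simp add: mid_part_def)

lemma mid_part_closed:
  "\<lbrakk>bi_closed M; x \<in> carrier (D2_sum M)\<rbrakk> \<Longrightarrow> mid_part \<zero>\<^bsub>M\<^esub> x \<in> carrier M"
  by (auto simp: mid_part_def D2_sum_def bi_subuniverse_def)

text \<open>A valuation in \<open>D2_sum M\<close> is determined by the pattern \<open>g\<close> of bounds and inner elements and by a
valuation \<open>d\<close> in \<open>M\<close> of the inner variables. For a fixed pattern, both sides of \<open>q\<close> reduce symbolically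
to \<open>Bot\<close>, \<open>Top\<close> or inner BI-terms. Since \<open>q\<close> holds in \<open>D2_sum N\<close>, the results are the same bound, or two
inner terms forming an equation of \<open>N\<close>, hence of \<open>M\<close>.\<close>

lemma D2_sum_sat_mono:
  fixes q :: "'v bz_term \<times> 'v bz_term"
  assumes N: "bi_closed N" and M: "bi_closed M"
    and sat: "\<And>p :: 'v bi_term \<times> 'v bi_term. N \<Turnstile>\<^sub>B\<^sub>I p \<Longrightarrow> M \<Turnstile>\<^sub>B\<^sub>I p"
    and q: "D2_sum N \<Turnstile>\<^sub>B\<^sub>Z q"
  shows "D2_sum M \<Turnstile>\<^sub>B\<^sub>Z q"
  unfolding bz_sat_def
proof (intro allI impI)
  fix e :: "'v \<Rightarrow> _" assume e: "\<forall>x. e x \<in> carrier (D2_sum M)"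
  define g where "g v = (case e v of Bot \<Rightarrow> Bot | Mid a \<Rightarrow> Mid (BIVar v) | Top \<Rightarrow> Top)" for v
  define d where "d v = mid_part \<zero>\<^bsub>M\<^esub> (e v)" for v
  have d: "d v \<in> carrier M" for v
    using e M by (simp add: d_def mid_part_closed)
  have e_eq: "e = (\<lambda>v. map_d2_ext (bi_eval M d) (g v))"
    by (auto simp: g_def d_def fun_eq_iff split: d2_ext.split)
  define s r where "s = bz_eval (D2_sum term_alg) g (fst q)"
    and "r = bz_eval (D2_sum term_alg) g (snd q)"
  have eq: "map_d2_ext (bi_eval N d') s = map_d2_ext (bi_eval N d') r"
    if d': "\<And>v. d' v \<in> carrier N" for d'
  proof -
    have "map_d2_ext (bi_eval N d') (g v) \<in> carrier (D2_sum N)" for v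
      using d' by (simp add: g_def D2_sum_def split: d2_ext.split)
    then show ?thesis
      using q by (simp add: bz_sat_def s_def r_def flip: D2_sum_eval[OF N d'])
  qed
  have N0: "\<zero>\<^bsub>N\<^esub> \<in> carrier N"
    using N by (simp add: bi_subuniverse_def)
  \<comment> \<open>Constructors of the two results can be compared as soon as N has one valuation.\<close>
  have "map_d2_ext (bi_eval M d) s = map_d2_ext (bi_eval M d) r"
  proof (cases "\<exists>s' r'. s = Mid s' \<and> r = Mid r'")
    case True
    then obtain s' r' where sr: "s = Mid s'" "r = Mid r'" by blast
    then have "N \<Turnstile>\<^sub>B\<^sub>I (s', r')"
      using eq by (simp add: bi_sat_def)
    then show ?thesis
      using sat[of "(s', r')"] d by (simp add: bi_sat_def sr)
  next
    case False
    then have "s = r"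
      using eq[OF N0] by (cases s; cases r) auto
    then show ?thesis by simp
  qed
  then show "bz_eval (D2_sum M) e (fst q) = bz_eval (D2_sum M) e (snd q)"
    by (simp add: e_eq D2_sum_eval[OF M d] s_def r_def)
qed

text \<open>The result of removing the constants from a term by the laws of \<open>0\<close> and \<open>1\<close> in bounded lattices: a
bound, or a term without constants. These laws are those by which \<open>D2_sum\<close> treats its new
bounds.\<close>

definition bound_normal :: "'v bi_term \<Rightarrow> 'v bi_term d2_ext" where
  "bound_normal = bi_eval (D2_sum term_alg) (\<lambda>v. Mid (BIVar v))"

lemma bi_eval_bound_normal:
  assumes L: "bi_lattice L" and e: "\<And>v. e v \<in> carrier L"
  shows "bi_eval L e t =
    (case bound_normal t of Bot \<Rightarrow> \<zero>\<^bsub>L\<^esub> | Mid s \<Rightarrow> bi_eval L e s | Top \<Rightarrow> \<one>\<^bsub>L\<^esub>)"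
proof -
  interpret bi_lattice L by (rule L)
  note ev = bi_eval_closed[OF bi_closed, of e, OF e]
  show ?thesis
  proof (induction t)
    case (BIInv t)
    then show ?case
      by (cases "bound_normal t") (simp_all add: bound_normal_def D2_sum_def term_alg_def zero_inv one_inv)
  next
    case (BIMeet s t)
    then show ?case
      by (cases "bound_normal s"; cases "bound_normal t")
        (simp_all add: bound_normal_def D2_sum_def term_alg_def bounds ev zero_closed one_closed)
  next
    case (BIJoin s t)
    then show ?case
      by (cases "bound_normal s"; cases "bound_normal t")
        (simp_all add: bound_normal_def D2_sum_def term_alg_def bounds ev zero_closed one_closed)
  qed (simp_all add: bound_normal_def D2_sum_def term_alg_def)
qed

lemma bi_eval_D2_sum_Mid:
  assumes "bi_closed N" "\<And>v. d v \<in> carrier N"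
  shows "bi_eval (D2_sum N) (\<lambda>v. Mid (d v)) t = map_d2_ext (bi_eval N d) (bound_normal t)"
  using D2_sum_eval[OF assms, where g = "\<lambda>v. Mid (BIVar v)" and t = "bz_of_bi t"]
  by (simp add: bz_eval_bz_of_bi bound_normal_def)

section \<open>Guarded terms\<close>

definition guarded :: "'v list \<Rightarrow> 'v bz_term \<Rightarrow> 'v bz_term" where
  "guarded vs s = foldr (\<lambda>v r. Join (brw_kleene (Var v)) r) vs s"

text \<open>The guard \<open>(v \<and> v')\<^sup>\<sim>\<close> is \<open>Top\<close> if \<open>v\<close> is a bound, which absorbs the whole join, and \<open>Bot\<close> otherwise.\<close>

lemma guarded_eval:
  "bz_eval (D2_sum M) e (guarded vs s)
    = (if \<forall>v\<in>set vs. e v \<in> range Mid then bz_eval (D2_sum M) e s else Top)"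
proof (induction vs)
  case (Cons v vs)
  have "bz_eval (D2_sum M) e (brw_kleene (Var v)) = (if e v \<in> range Mid then Bot else Top)"
    by (cases "e v") (auto simp: brw_kleene_def D2_sum_def)
  moreover have "bz_eval (D2_sum M) e (guarded (v # vs) s)
    = d2_join (bi_join M) (bz_eval (D2_sum M) e (brw_kleene (Var v)))
        (bz_eval (D2_sum M) e (guarded vs s))"
    by (simp add: guarded_def D2_sum_def)
  ultimately show ?case
    using Cons.IH by simp
qed (simp add: guarded_def)

text \<open>The guards restrict the equation to inner values of all variables. For these, \<open>t\<close> and \<open>u\<close> are computed
in \<open>D2_sum M\<close> as in \<open>M\<close>, because by assumption they do not reduce to a bound; otherwise their value in
\<open>D2_sum M\<close> would be a new bound and not an element of \<open>M\<close>.\<close>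

lemma guarded_sat_iff:
  fixes t u :: "'v bi_term"
  assumes M: "bi_lattice M" and t: "bound_normal t = Mid t'" and u: "bound_normal u = Mid u'"
    and vs: "bi_vars t \<union> bi_vars u \<subseteq> set vs"
  shows "D2_sum M \<Turnstile>\<^sub>B\<^sub>Z (guarded vs (bz_of_bi t), guarded vs (bz_of_bi u)) \<longleftrightarrow> M \<Turnstile>\<^sub>B\<^sub>I (t, u)"
proof -
  interpret M: bi_lattice M by (rule M)
  have eval: "bi_eval (D2_sum M) (\<lambda>v. Mid (d v)) t = Mid (bi_eval M d t)"
    "bi_eval (D2_sum M) (\<lambda>v. Mid (d v)) u = Mid (bi_eval M d u)"
    if "\<And>v. d v \<in> carrier M" for d
    using bi_eval_D2_sum_Mid[OF M.bi_closed, of d, OF that] bi_eval_bound_normal[OF M, of d, OF that] t u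
    by simp_all
  show ?thesis
  proof
    assume sat: "D2_sum M \<Turnstile>\<^sub>B\<^sub>Z (guarded vs (bz_of_bi t), guarded vs (bz_of_bi u))"
    show "M \<Turnstile>\<^sub>B\<^sub>I (t, u)"
      unfolding bi_sat_def
    proof (intro allI impI)
      fix d :: "'v \<Rightarrow> _" assume d: "\<forall>x. d x \<in> carrier M"
      then have "\<forall>v. Mid (d v) \<in> carrier (D2_sum M)"
        by (simp add: D2_sum_def)
      then have "bz_eval (D2_sum M) (\<lambda>v. Mid (d v)) (guarded vs (bz_of_bi t))
          = bz_eval (D2_sum M) (\<lambda>v. Mid (d v)) (guarded vs (bz_of_bi u))"
        using sat by (simp add: bz_sat_def)
      then show "bi_eval M d (fst (t, u)) = bi_eval M d (snd (t, u))"
        using d by (simp add: guarded_eval bz_eval_bz_of_bi eval)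
    qed
  next
    assume sat: "M \<Turnstile>\<^sub>B\<^sub>I (t, u)"
    show "D2_sum M \<Turnstile>\<^sub>B\<^sub>Z (guarded vs (bz_of_bi t), guarded vs (bz_of_bi u))"
      unfolding bz_sat_def
    proof (intro allI impI)
      fix e :: "'v \<Rightarrow> _" assume e: "\<forall>x. e x \<in> carrier (D2_sum M)"
      define d where "d v = mid_part \<zero>\<^bsub>M\<^esub> (e v)" for v
      have d: "d v \<in> carrier M" for v
        using e by (simp add: d_def mid_part_closed M.bi_closed)
      have "bi_eval (D2_sum M) e t = bi_eval (D2_sum M) e u" if "\<forall>v\<in>set vs. e v \<in> range Mid"
      proof -
        have ev: "e v = Mid (d v)" if "v \<in> bi_vars t \<union> bi_vars u" for v
        proof -
          have "e v \<in> range Mid"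
            using that vs \<open>\<forall>v\<in>set vs. e v \<in> range Mid\<close> by blast
          then show ?thesis by (auto simp: d_def)
        qed
        have "bi_eval (D2_sum M) e t = bi_eval (D2_sum M) (\<lambda>v. Mid (d v)) t"
          by (rule bi_eval_cong) (simp add: ev)
        also have "\<dots> = bi_eval (D2_sum M) (\<lambda>v. Mid (d v)) u"
          using sat d by (simp add: eval bi_sat_def)
        also have "\<dots> = bi_eval (D2_sum M) e u"
          by (rule bi_eval_cong) (simp add: ev)
        finally show ?thesis .
      qed
      then show "bz_eval (D2_sum M) e (fst (guarded vs (bz_of_bi t), guarded vs (bz_of_bi u)))
          = bz_eval (D2_sum M) e (snd (guarded vs (bz_of_bi t), guarded vs (bz_of_bi u)))"
        by (simp add: guarded_eval bz_eval_bz_of_bi)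
    qed
  qed
qed

lemma finite_bi_vars: "finite (bi_vars t)"
  by (induction t) auto

lemma D2_sum_m_equation_iff:
  fixes t u :: "nat bi_term"
  assumes "bi_lattice M" "bound_normal t = Mid t'" "bound_normal u = Mid u'"
  shows "D2_sum M \<Turnstile>\<^sub>B\<^sub>Z m_equation t u \<longleftrightarrow> M \<Turnstile>\<^sub>B\<^sub>I (t, u)"
proof -
  define vs where "vs = sorted_list_of_set (bi_vars t - bi_vars u) @
        sorted_list_of_set (bi_vars u - bi_vars t) @
        sorted_list_of_set (bi_vars t \<inter> bi_vars u)"
  have "m_equation t u = (guarded vs (bz_of_bi t), guarded vs (bz_of_bi u))"
    by (simp add: m_equation_def m_with_def guarded_def vs_def)
  moreover have "bi_vars t \<union> bi_vars u \<subseteq> set vs"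
    by (auto simp: vs_def finite_bi_vars)
  ultimately show ?thesis
    using guarded_sat_iff[OF assms] by simp
qed

section \<open>The antiortholattices \<open>D\<^sub>2 \<oplus> M \<oplus> D\<^sub>2\<close>\<close>

lemma J0_sat_iff:
  "L \<Turnstile>\<^sub>B\<^sub>Z J0 \<longleftrightarrow> (\<forall>x\<in>carrier L. \<forall>y\<in>carrier L.
     (x \<sqinter>\<^bsub>L\<^esub> y\<^sup>\<sim>\<^bsub>L\<^esub>) \<squnion>\<^bsub>L\<^esub> (x \<sqinter>\<^bsub>L\<^esub> y\<^sup>\<sim>\<^bsub>L\<^esub>\<^sup>\<sim>\<^bsub>L\<^esub>) = x)"
proof
  assume *: "L \<Turnstile>\<^sub>B\<^sub>Z J0"
  show "\<forall>x\<in>carrier L. \<forall>y\<in>carrier L.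
     (x \<sqinter>\<^bsub>L\<^esub> y\<^sup>\<sim>\<^bsub>L\<^esub>) \<squnion>\<^bsub>L\<^esub> (x \<sqinter>\<^bsub>L\<^esub> y\<^sup>\<sim>\<^bsub>L\<^esub>\<^sup>\<sim>\<^bsub>L\<^esub>) = x"
    using bz_sat_val3[OF *[unfolded J0_def Let_def]] by (simp add: val3_def)
qed (simp add: bz_sat_def J0_def Let_def)

lemma D2OL_sat_iff:
  "L \<Turnstile>\<^sub>B\<^sub>Z D2OL_join \<longleftrightarrow> (\<forall>x\<in>carrier L. \<forall>y\<in>carrier L.
     (((x \<sqinter>\<^bsub>L\<^esub> x\<acute>\<^bsub>L\<^esub>)\<^sup>\<sim>\<^bsub>L\<^esub> \<squnion>\<^bsub>L\<^esub> (y \<sqinter>\<^bsub>L\<^esub> y\<acute>\<^bsub>L\<^esub>)\<^sup>\<sim>\<^bsub>L\<^esub>) \<squnion>\<^bsub>L\<^esub> x) \<squnion>\<^bsub>L\<^esub> x\<acute>\<^bsub>L\<^esub> =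
     (((x \<sqinter>\<^bsub>L\<^esub> x\<acute>\<^bsub>L\<^esub>)\<^sup>\<sim>\<^bsub>L\<^esub> \<squnion>\<^bsub>L\<^esub> (y \<sqinter>\<^bsub>L\<^esub> y\<acute>\<^bsub>L\<^esub>)\<^sup>\<sim>\<^bsub>L\<^esub>) \<squnion>\<^bsub>L\<^esub> y) \<squnion>\<^bsub>L\<^esub> y\<acute>\<^bsub>L\<^esub>)"
    (is "?l = ?r")
proof
  assume *: ?l
  show ?r
  proof (intro ballI)
    fix x y assume "x \<in> carrier L" "y \<in> carrier L"
    then show "(((x \<sqinter>\<^bsub>L\<^esub> x\<acute>\<^bsub>L\<^esub>)\<^sup>\<sim>\<^bsub>L\<^esub> \<squnion>\<^bsub>L\<^esub> (y \<sqinter>\<^bsub>L\<^esub> y\<acute>\<^bsub>L\<^esub>)\<^sup>\<sim>\<^bsub>L\<^esub>) \<squnion>\<^bsub>L\<^esub> x) \<squnion>\<^bsub>L\<^esub> x\<acute>\<^bsub>L\<^esub> =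
     (((x \<sqinter>\<^bsub>L\<^esub> x\<acute>\<^bsub>L\<^esub>)\<^sup>\<sim>\<^bsub>L\<^esub> \<squnion>\<^bsub>L\<^esub> (y \<sqinter>\<^bsub>L\<^esub> y\<acute>\<^bsub>L\<^esub>)\<^sup>\<sim>\<^bsub>L\<^esub>) \<squnion>\<^bsub>L\<^esub> y) \<squnion>\<^bsub>L\<^esub> y\<acute>\<^bsub>L\<^esub>"
      using bz_sat_val3[OF *[unfolded D2OL_join_def Let_def], of x y x]
      by (simp add: val3_def brw_kleene_def)
  qed
qed (auto simp: bz_sat_def D2OL_join_def Let_def brw_kleene_def)

context ortholattice
begin

lemma D2_sum_pbz_star: "pbz_star_lattice (D2_sum L)"
proof -
  note cl = meet_closed join_closed inv_closed zero_closed one_closed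
  show ?thesis
  proof
    fix x y z
    assume x: "x \<in> carrier (D2_sum L)" and y: "y \<in> carrier (D2_sum L)"
      and z: "z \<in> carrier (D2_sum L)"
    show "(x \<sqinter>\<^bsub>D2_sum L\<^esub> y) \<sqinter>\<^bsub>D2_sum L\<^esub> z = x \<sqinter>\<^bsub>D2_sum L\<^esub> (y \<sqinter>\<^bsub>D2_sum L\<^esub> z)"
      "(x \<squnion>\<^bsub>D2_sum L\<^esub> y) \<squnion>\<^bsub>D2_sum L\<^esub> z = x \<squnion>\<^bsub>D2_sum L\<^esub> (y \<squnion>\<^bsub>D2_sum L\<^esub> z)"
      using x y z by (auto simp: D2_sum_def meet_assoc join_assoc)
  next
    fix x y assume x: "x \<in> carrier (D2_sum L)" and y: "y \<in> carrier (D2_sum L)"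
    show "x \<sqinter>\<^bsub>D2_sum L\<^esub> y \<in> carrier (D2_sum L)" "x \<squnion>\<^bsub>D2_sum L\<^esub> y \<in> carrier (D2_sum L)"
      using x y by (auto simp: D2_sum_def cl)
    show "x \<sqinter>\<^bsub>D2_sum L\<^esub> y = y \<sqinter>\<^bsub>D2_sum L\<^esub> x" "x \<squnion>\<^bsub>D2_sum L\<^esub> y = y \<squnion>\<^bsub>D2_sum L\<^esub> x"
      using x y by (auto simp: D2_sum_def meet_comm join_comm)
    show "x \<sqinter>\<^bsub>D2_sum L\<^esub> (x \<squnion>\<^bsub>D2_sum L\<^esub> y) = x" "x \<squnion>\<^bsub>D2_sum L\<^esub> (x \<sqinter>\<^bsub>D2_sum L\<^esub> y) = x"
      using x y by (auto simp: D2_sum_def meet_absorb join_absorb meet_idem join_idem)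
    show "x \<sqinter>\<^bsub>D2_sum L\<^esub> x\<acute>\<^bsub>D2_sum L\<^esub> \<sqsubseteq>\<^bsub>D2_sum L\<^esub> y \<squnion>\<^bsub>D2_sum L\<^esub> y\<acute>\<^bsub>D2_sum L\<^esub>"
      using x y by (auto simp: D2_sum_def bi_le_def meet_inv join_inv bounds cl)
    show "y\<acute>\<^bsub>D2_sum L\<^esub> \<sqsubseteq>\<^bsub>D2_sum L\<^esub> x\<acute>\<^bsub>D2_sum L\<^esub>" if "x \<sqsubseteq>\<^bsub>D2_sum L\<^esub> y"
      using x y that inv_antitone by (auto simp: D2_sum_def bi_le_def)
    show "y\<^sup>\<sim>\<^bsub>D2_sum L\<^esub> \<sqsubseteq>\<^bsub>D2_sum L\<^esub> x\<^sup>\<sim>\<^bsub>D2_sum L\<^esub>" if "x \<sqsubseteq>\<^bsub>D2_sum L\<^esub> y"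
      using x y that by (auto simp: D2_sum_def bi_le_def)
    show "x = y" if "x \<sqsubseteq>\<^bsub>D2_sum L\<^esub> y" "x\<acute>\<^bsub>D2_sum L\<^esub> \<sqinter>\<^bsub>D2_sum L\<^esub> y = \<zero>\<^bsub>D2_sum L\<^esub>"
      using x y that by (auto simp: D2_sum_def bi_le_def)
  qed (auto simp: D2_sum_def bi_le_def inv_involutive inv_closed)
qed

lemma D2_sum_J0: "D2_sum L \<Turnstile>\<^sub>B\<^sub>Z J0"
  by (auto simp: J0_sat_iff D2_sum_def)

lemma D2_sum_D2OL: "D2_sum L \<Turnstile>\<^sub>B\<^sub>Z D2OL_join"
  by (auto simp: D2OL_sat_iff D2_sum_def join_inv)

end

lemma B6_ortholattice: "ortholattice B6"
proof
  fix x y z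
  show "(x \<sqinter>\<^bsub>B6\<^esub> y) \<sqinter>\<^bsub>B6\<^esub> z = x \<sqinter>\<^bsub>B6\<^esub> (y \<sqinter>\<^bsub>B6\<^esub> z)"
    "(x \<squnion>\<^bsub>B6\<^esub> y) \<squnion>\<^bsub>B6\<^esub> z = x \<squnion>\<^bsub>B6\<^esub> (y \<squnion>\<^bsub>B6\<^esub> z)"
    by (cases x; cases y; cases z; simp add: B6_def)+
next
  fix x y
  show "x \<sqinter>\<^bsub>B6\<^esub> y = y \<sqinter>\<^bsub>B6\<^esub> x" "x \<squnion>\<^bsub>B6\<^esub> y = y \<squnion>\<^bsub>B6\<^esub> x" "x \<sqinter>\<^bsub>B6\<^esub> (x \<squnion>\<^bsub>B6\<^esub> y) = x"
    "x \<squnion>\<^bsub>B6\<^esub> (x \<sqinter>\<^bsub>B6\<^esub> y) = x" "x \<sqsubseteq>\<^bsub>B6\<^esub> y \<Longrightarrow> y\<acute>\<^bsub>B6\<^esub> \<sqsubseteq>\<^bsub>B6\<^esub> x\<acute>\<^bsub>B6\<^esub>"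
    by (cases x; cases y; simp add: B6_def bi_le_def)+
next
  fix x
  show "\<zero>\<^bsub>B6\<^esub> \<sqsubseteq>\<^bsub>B6\<^esub> x" "x \<sqsubseteq>\<^bsub>B6\<^esub> \<one>\<^bsub>B6\<^esub>" "x\<acute>\<^bsub>B6\<^esub>\<acute>\<^bsub>B6\<^esub> = x" "x \<squnion>\<^bsub>B6\<^esub> x\<acute>\<^bsub>B6\<^esub> = \<one>\<^bsub>B6\<^esub>"
    by (cases x; simp add: B6_def bi_le_def)+
qed (simp_all add: B6_def)

section \<open>Images of algebras under maps with a congruence as kernel\<close>

text \<open>The quotient of \<open>A\<close> by the kernel of \<open>f\<close>, with the values of \<open>f\<close> as names of the classes. With injective
\<open>f\<close> it is a copy of \<open>A\<close> in another type; with \<open>f\<close> choosing a representative of each class of a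
congruence it is a quotient in the same type.\<close>

definition bi_image :: "('a \<Rightarrow> 'b) \<Rightarrow> ('a, 'm) bi_alg_scheme \<Rightarrow> 'b bi_alg" where
  "bi_image f A = (let g = inv_into (carrier A) f in
    \<lparr>carrier = f ` carrier A,
     bi_meet = (\<lambda>x y. f (g x \<sqinter>\<^bsub>A\<^esub> g y)),
     bi_join = (\<lambda>x y. f (g x \<squnion>\<^bsub>A\<^esub> g y)),
     bi_inv = (\<lambda>x. f ((g x)\<acute>\<^bsub>A\<^esub>)),
     bi_zero = f \<zero>\<^bsub>A\<^esub>,
     bi_one = f \<one>\<^bsub>A\<^esub>\<rparr>)"

definition bz_image :: "('a \<Rightarrow> 'b) \<Rightarrow> ('a, 'm) bz_alg_scheme \<Rightarrow> 'b bz_alg" where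
  "bz_image f A =
    \<lparr>carrier = f ` carrier A,
     bi_meet = bi_meet (bi_image f A),
     bi_join = bi_join (bi_image f A),
     bi_inv = bi_inv (bi_image f A),
     bi_zero = bi_zero (bi_image f A),
     bi_one = bi_one (bi_image f A),
     bz_brw = (\<lambda>x. f ((inv_into (carrier A) f x)\<^sup>\<sim>\<^bsub>A\<^esub>))\<rparr>"

lemma bi_image_carrier [simp]: "carrier (bi_image f A) = f ` carrier A"
  by (simp add: bi_image_def Let_def)

lemma bz_image_carrier [simp]: "carrier (bz_image f A) = f ` carrier A"
  by (simp add: bz_image_def)

lemma bi_image_hom:
  assumes meet: "\<And>x x' y y'. \<lbrakk>x \<in> carrier A; x' \<in> carrier A; y \<in> carrier A; y' \<in> carrier A;
        f x = f x'; f y = f y'\<rbrakk> \<Longrightarrow> f (x \<sqinter>\<^bsub>A\<^esub> y) = f (x' \<sqinter>\<^bsub>A\<^esub> y')"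
    and join: "\<And>x x' y y'. \<lbrakk>x \<in> carrier A; x' \<in> carrier A; y \<in> carrier A; y' \<in> carrier A;
        f x = f x'; f y = f y'\<rbrakk> \<Longrightarrow> f (x \<squnion>\<^bsub>A\<^esub> y) = f (x' \<squnion>\<^bsub>A\<^esub> y')"
    and inv: "\<And>x x'. \<lbrakk>x \<in> carrier A; x' \<in> carrier A; f x = f x'\<rbrakk>
        \<Longrightarrow> f (x\<acute>\<^bsub>A\<^esub>) = f (x'\<acute>\<^bsub>A\<^esub>)"
  shows "f \<in> bi_hom A (bi_image f A)"
proof -
  have g: "inv_into (carrier A) f (f x) \<in> carrier A" "f (inv_into (carrier A) f (f x)) = f x"
    if "x \<in> carrier A" for x
    using that by (auto intro: inv_into_into f_inv_into_f)
  show ?thesis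
    unfolding bi_hom_def
    by (auto simp: bi_image_def Let_def g intro!: meet join inv)
qed

lemma bz_image_hom:
  assumes bi: "f \<in> bi_hom A (bi_image f A)"
    and brw: "\<And>x x'. \<lbrakk>x \<in> carrier A; x' \<in> carrier A; f x = f x'\<rbrakk>
        \<Longrightarrow> f (x\<^sup>\<sim>\<^bsub>A\<^esub>) = f (x'\<^sup>\<sim>\<^bsub>A\<^esub>)"
  shows "f \<in> bz_hom A (bz_image f A)"
proof -
  have g: "inv_into (carrier A) f (f x) \<in> carrier A" "f (inv_into (carrier A) f (f x)) = f x"
    if "x \<in> carrier A" for x
    using that by (auto intro: inv_into_into f_inv_into_f)
  then show ?thesis
    using bi unfolding bz_hom_def
    by (auto simp: bz_image_def bi_hom_def intro!: brw)
qed

lemma bi_image_inj_hom: "inj_on f (carrier A) \<Longrightarrow> f \<in> bi_hom A (bi_image f A)"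
  by (rule bi_image_hom) (simp_all add: inj_on_eq_iff)

lemma bz_image_inj_hom: "inj_on f (carrier A) \<Longrightarrow> f \<in> bz_hom A (bz_image f A)"
  by (rule bz_image_hom[OF bi_image_inj_hom]) (simp_all add: inj_on_eq_iff)

section \<open>Central elements of lattices with J0\<close>

context bz_lattice
begin

lemmas op_closed = meet_closed join_closed inv_closed brw_closed zero_closed one_closed

lemma zero_brw: "\<zero>\<^sup>\<sim> = \<one>"
proof -
  have "\<one>\<^sup>\<sim> = \<zero>"
    using meet_brw[of \<one>] by (simp add: bounds op_closed)
  then have "\<zero>\<^sup>\<sim> = \<zero>\<acute>"
    using brw_brw[of \<one>] by (simp add: op_closed)
  then show ?thesis by (simp add: zero_inv)
qed

end

locale j0_lattice = bz_lattice +
  assumes J0: "\<lbrakk>x \<in> carrier L; y \<in> carrier L\<rbrakk> \<Longrightarrow> (x \<sqinter> y\<^sup>\<sim>) \<squnion> (x \<sqinter> y\<^sup>\<sim>\<^sup>\<sim>) = x"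
begin

lemma brw_le_inv: "x \<in> carrier L \<Longrightarrow> x\<^sup>\<sim> \<sqsubseteq> x\<acute>"
  using inv_antitone[OF _ _ le_brw_brw, of x] brw_brw[of x] by (simp add: op_closed inv_involutive)

lemma le_brw_swap:
  assumes "x \<in> carrier L" "y \<in> carrier L" "x \<sqsubseteq> y\<^sup>\<sim>"
  shows "y \<sqsubseteq> x\<^sup>\<sim>"
proof (rule le_trans[OF _ _ _ le_brw_brw])
  show "y\<^sup>\<sim>\<^sup>\<sim> \<sqsubseteq> x\<^sup>\<sim>"
    using assms by (simp add: brw_antitone op_closed)
qed (use assms in \<open>simp_all add: op_closed\<close>)

text \<open>If \<open>x \<le> y\<close> and \<open>x' \<and> y = 0\<close>, then \<open>x \<and> x' = 0\<close>. The star condition gives \<open>\<Diamond>x \<and> \<Diamond>x' = 0\<close>, so that splitting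
\<open>\<Diamond>x\<close> along \<open>x'\<close> by J0 yields \<open>\<Diamond>x = \<Diamond>x \<and> x'\<^sup>\<sim> \<le> x\<close> and hence \<open>x' = x\<^sup>\<sim>\<close>. Splitting \<open>y\<close> along \<open>x\<close> then
yields \<open>y = (y \<and> x') \<or> (y \<and> x) = x\<close>.\<close>

lemma pbz_starI:
  assumes star: "\<And>x. x \<in> carrier L \<Longrightarrow> (x \<sqinter> x\<acute>)\<^sup>\<sim> = x\<^sup>\<sim> \<squnion> x\<acute>\<^sup>\<sim>"
  shows "pbz_star_lattice L"
proof
  fix x y assume x: "x \<in> carrier L" and y: "y \<in> carrier L"
    and le: "x \<sqsubseteq> y" and zero: "x\<acute> \<sqinter> y = \<zero>"
  note c = x y op_closed
  have "x \<sqinter> x\<acute> = \<zero>"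
    using le zero x y unfolding bi_le_def by (metis bounds(2) inv_closed meet_assoc meet_comm)
  then have join: "x\<^sup>\<sim> \<squnion> x\<acute>\<^sup>\<sim> = \<one>"
    using star[OF x] zero_brw by simp
  have meet: "x\<^sup>\<sim>\<^sup>\<sim> \<sqinter> x\<acute>\<^sup>\<sim>\<^sup>\<sim> = \<zero>"
    using arg_cong[OF join, of "bi_inv L"] c by (simp add: join_inv_eq one_inv brw_brw)
  have x'_eq: "x\<acute> = x\<^sup>\<sim>"
  proof -
    have "x\<acute>\<^sup>\<sim> \<sqsubseteq> x"
      using brw_le_inv[of "x\<acute>"] c by (simp add: inv_involutive)
    then have "x\<^sup>\<sim>\<^sup>\<sim> \<sqinter> x\<acute>\<^sup>\<sim> \<sqsubseteq> x"
      using c by (simp add: meet_le_trans2)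
    moreover have "x\<^sup>\<sim>\<^sup>\<sim> \<sqinter> x\<acute>\<^sup>\<sim> = x\<^sup>\<sim>\<^sup>\<sim>"
      using J0[of "x\<^sup>\<sim>\<^sup>\<sim>" "x\<acute>"] meet c by (simp add: bounds)
    ultimately have "x\<^sup>\<sim>\<^sup>\<sim> = x"
      using le_brw_brw[OF x] c by (simp add: le_antisym)
    then have "x\<^sup>\<sim>\<acute>\<acute> = x\<acute>"
      using brw_brw[OF x] by simp
    then show ?thesis using c by (simp add: inv_involutive)
  qed
  then have "x\<^sup>\<sim>\<^sup>\<sim> = x"
    using brw_brw[OF x] inv_involutive[OF x] by simp
  then have "(y \<sqinter> x\<acute>) \<squnion> (y \<sqinter> x) = y"
    using J0[OF y x] x'_eq by simp
  then show "x = y"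
    using zero le c by (simp add: meet_comm[of y] bounds bi_le_def)
qed (rule star)

text \<open>J0 makes these elements central in the lattice-theoretic sense, whence the name.\<close>

definition central :: "'a set" where
  "central = (\<lambda>x. x\<^sup>\<sim>) ` carrier L"

lemma central_carrier: "c \<in> central \<Longrightarrow> c \<in> carrier L"
  by (auto simp: central_def brw_closed)

lemma central_brw: "x \<in> carrier L \<Longrightarrow> x\<^sup>\<sim> \<in> central"
  by (simp add: central_def)

lemma central_inv: "c \<in> central \<Longrightarrow> c\<acute> \<in> central"
  by (auto simp: central_def brw_closed simp flip: brw_brw)

lemma central_brw_eq_inv: "c \<in> central \<Longrightarrow> c\<^sup>\<sim> = c\<acute>"
  by (auto simp: central_def brw_brw)

lemma central_one: "\<one> \<in> central"
  using central_brw[OF zero_closed] by (simp add: zero_brw)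

lemma central_meet_inv: "c \<in> central \<Longrightarrow> c \<sqinter> c\<acute> = \<zero>"
  using meet_brw[of c] central_brw_eq_inv central_carrier by simp

text \<open>Since \<open>\<sim>\<close> is a Galois connection of \<open>L\<close> with itself (\<open>le_brw_swap\<close>), \<open>x\<^sup>\<sim> \<and> y\<^sup>\<sim> = (x \<or> y)\<^sup>\<sim>\<close>.\<close>

lemma central_meet:
  assumes "c \<in> central" "d \<in> central"
  shows "c \<sqinter> d \<in> central"
proof -
  obtain x y where xy: "x \<in> carrier L" "y \<in> carrier L" and cd: "c = x\<^sup>\<sim>" "d = y\<^sup>\<sim>"
    using assms by (auto simp: central_def)
  let ?m = "x\<^sup>\<sim> \<sqinter> y\<^sup>\<sim>"
  have m: "?m \<in> carrier L" using xy by (simp add: op_closed)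
  have "(x \<squnion> y)\<^sup>\<sim> \<sqsubseteq> ?m"
    using xy by (intro meet_greatest brw_antitone join_ge1 join_ge2) (simp_all add: op_closed)
  moreover have "?m \<sqsubseteq> (x \<squnion> y)\<^sup>\<sim>"
  proof -
    have "x \<sqsubseteq> ?m\<^sup>\<sim>" "y \<sqsubseteq> ?m\<^sup>\<sim>"
      using xy by (auto intro!: le_brw_swap meet_le1 meet_le2 op_closed)
    then have "x \<squnion> y \<sqsubseteq> ?m\<^sup>\<sim>"
      using xy m by (simp add: join_least op_closed)
    then show ?thesis
      using xy m by (auto intro!: le_brw_swap op_closed)
  qed
  ultimately have "?m = (x \<squnion> y)\<^sup>\<sim>"
    using xy m by (simp add: le_antisym op_closed)
  then show ?thesis using xy by (simp add: cd central_brw op_closed)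
qed

lemma central_split:
  assumes "x \<in> carrier L" "c \<in> central"
  shows "(x \<sqinter> c) \<squnion> (x \<sqinter> c\<acute>) = x"
proof -
  obtain y where y: "y \<in> carrier L" "c = y\<^sup>\<sim>"
    using assms(2) by (auto simp: central_def)
  show ?thesis
    using J0[OF assms(1) y(1)] brw_brw[OF y(1)] y(2) by simp
qed

lemma central_split':
  assumes x: "x \<in> carrier L" and c: "c \<in> central"
  shows "(x \<squnion> c) \<sqinter> (x \<squnion> c\<acute>) = x"
proof -
  note cc = central_carrier[OF c]
  have "((x\<acute> \<sqinter> c) \<squnion> (x\<acute> \<sqinter> c\<acute>))\<acute> = x"
    using central_split[of "x\<acute>" c] x c by (simp add: op_closed inv_involutive)
  then have "(x \<squnion> c\<acute>) \<sqinter> (x \<squnion> c) = x"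
    using x cc by (simp add: join_inv_eq meet_inv_eq op_closed inv_involutive)
  then show ?thesis
    using x cc by (simp only: meet_comm[of "x \<squnion> c" "x \<squnion> c\<acute>"] op_closed)
qed

text \<open>Put \<open>p = (x \<and> c) \<or> (y \<and> c)\<close>. Splitting \<open>x\<close> and \<open>y\<close> along \<open>c\<close> gives \<open>x \<or> y \<le> p \<or> c'\<close>, and
\<open>(p \<or> c') \<and> c = (p \<or> c') \<and> (p \<or> c) = p\<close> by the dual of the splitting.\<close>

lemma central_distrib:
  assumes x: "x \<in> carrier L" and y: "y \<in> carrier L" and c: "c \<in> central"
  shows "(x \<squnion> y) \<sqinter> c = (x \<sqinter> c) \<squnion> (y \<sqinter> c)"
proof -
  have cc: "c \<in> carrier L" using c by (rule central_carrier)
  note k = x y cc op_closed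
  define p where "p = (x \<sqinter> c) \<squnion> (y \<sqinter> c)"
  have p: "p \<in> carrier L" by (simp add: p_def k)
  have pc: "p \<sqsubseteq> c"
    unfolding p_def by (intro join_least meet_le2 k)
  have part: "z \<sqsubseteq> p \<squnion> c\<acute>" if z: "z \<in> carrier L" "z \<sqinter> c \<sqsubseteq> p" for z
  proof -
    have "(z \<sqinter> c) \<squnion> (z \<sqinter> c\<acute>) \<sqsubseteq> p \<squnion> c\<acute>"
    proof (rule join_least)
      show "z \<sqinter> c \<sqsubseteq> p \<squnion> c\<acute>"
        using z p k by (simp add: le_join_trans1)
      show "z \<sqinter> c\<acute> \<sqsubseteq> p \<squnion> c\<acute>"
        using z p k by (simp add: meet_le2 le_join_trans2)
    qed (simp_all add: z p k)
    then show ?thesis using central_split[OF z(1) c] by simp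
  qed
  have "x \<squnion> y \<sqsubseteq> p \<squnion> c\<acute>"
    by (intro join_least part) (simp_all add: p_def k join_ge1 join_ge2)
  then have "(x \<squnion> y) \<sqinter> c \<sqsubseteq> (p \<squnion> c\<acute>) \<sqinter> c"
    using p k by (intro meet_greatest meet_le2 meet_le_trans1) simp_all
  also have "(p \<squnion> c\<acute>) \<sqinter> c = p"
  proof -
    have "p \<squnion> c = c" using pc p k by (simp add: le_iff_join)
    then show ?thesis
      using central_split'[OF p c] p k by (simp add: meet_comm)
  qed
  finally have "(x \<squnion> y) \<sqinter> c \<sqsubseteq> p" .
  moreover have "p \<sqsubseteq> (x \<squnion> y) \<sqinter> c"
  proof (intro meet_greatest pc)
    show "p \<sqsubseteq> x \<squnion> y"
      unfolding p_def using k
      by (intro join_least meet_le_trans1) (simp_all add: join_ge1 join_ge2)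
  qed (simp_all add: p k)
  ultimately show ?thesis
    using p k by (simp add: le_antisym flip: p_def)
qed

lemma inv_meet_central:
  assumes x: "x \<in> carrier L" and c: "c \<in> central"
  shows "(x \<sqinter> c)\<acute> \<sqinter> c = x\<acute> \<sqinter> c"
proof -
  have cc: "c \<in> carrier L" using c by (rule central_carrier)
  have "(x\<acute> \<squnion> c\<acute>) \<sqinter> c = (x\<acute> \<sqinter> c) \<squnion> (c\<acute> \<sqinter> c)"
    using x cc c by (simp add: central_distrib op_closed)
  then show ?thesis
    using central_meet_inv[OF c] x cc by (simp add: meet_inv_eq meet_comm[of "c\<acute>"] bounds op_closed)
qed

text \<open>For \<open>w = (x \<and> c)\<^sup>\<sim> \<and> c\<close>, both \<open>x \<and> c\<close> and \<open>x \<and> c' \<le> c\<^sup>\<sim>\<close> lie below \<open>w\<^sup>\<sim>\<close>, hence so does their join \<open>x\<close>; by the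
Galois connection \<open>w \<le> x\<^sup>\<sim>\<close>.\<close>

lemma brw_meet_central:
  assumes x: "x \<in> carrier L" and c: "c \<in> central"
  shows "(x \<sqinter> c)\<^sup>\<sim> \<sqinter> c = x\<^sup>\<sim> \<sqinter> c"
proof (rule le_antisym)
  have cc: "c \<in> carrier L" using c by (rule central_carrier)
  note k = x cc op_closed
  show "(x \<sqinter> c)\<^sup>\<sim> \<sqinter> c \<in> carrier L" "x\<^sup>\<sim> \<sqinter> c \<in> carrier L" by (simp_all add: k)
  have "x\<^sup>\<sim> \<sqsubseteq> (x \<sqinter> c)\<^sup>\<sim>"
    by (intro brw_antitone meet_le1) (simp_all add: k)
  then show "x\<^sup>\<sim> \<sqinter> c \<sqsubseteq> (x \<sqinter> c)\<^sup>\<sim> \<sqinter> c"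
    using k by (intro meet_greatest meet_le2 meet_le_trans1) simp_all
  let ?w = "(x \<sqinter> c)\<^sup>\<sim> \<sqinter> c"
  have 1: "x \<sqinter> c \<sqsubseteq> ?w\<^sup>\<sim>"
    by (rule le_brw_swap) (simp_all add: k meet_le1)
  have "c\<^sup>\<sim> \<sqsubseteq> ?w\<^sup>\<sim>"
    by (intro brw_antitone meet_le2) (simp_all add: k)
  then have 2: "x \<sqinter> c\<acute> \<sqsubseteq> ?w\<^sup>\<sim>"
    using k by (simp add: central_brw_eq_inv[OF c] meet_le_trans2)
  have "x \<sqsubseteq> ?w\<^sup>\<sim>"
    using join_least[OF _ _ _ 1 2] central_split[OF x c] k by simp
  then have "?w \<sqsubseteq> x\<^sup>\<sim>"
    by (rule le_brw_swap[rotated 2]) (simp_all add: k)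
  then show "?w \<sqsubseteq> x\<^sup>\<sim> \<sqinter> c"
    using k by (intro meet_greatest meet_le2) simp_all
qed

section \<open>Stalks\<close>

text \<open>A maximal meet-closed set \<open>U\<close> of central elements \<open>c\<close> with \<open>a \<and> c \<noteq> b \<and> c\<close> is an ultrafilter. If it
contained neither \<open>c\<close> nor \<open>c'\<close>, then \<open>a\<close> and \<open>b\<close> would agree on \<open>f \<and> c\<close> and on \<open>f \<and> c'\<close> for some \<open>f \<in> U\<close>,
hence on \<open>f\<close> by splitting.\<close>

lemma separating_filter:
  assumes a: "a \<in> carrier L" and b: "b \<in> carrier L" and ab: "a \<noteq> b"
  obtains U where "U \<subseteq> central" "\<one> \<in> U" "\<And>c d. \<lbrakk>c \<in> U; d \<in> U\<rbrakk> \<Longrightarrow> c \<sqinter> d \<in> U"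
    "\<And>c. c \<in> U \<Longrightarrow> a \<sqinter> c \<noteq> b \<sqinter> c" "\<And>c. c \<in> central \<Longrightarrow> c \<in> U \<or> c\<acute> \<in> U"
proof -
  define F where "F = {U. U \<subseteq> central \<and> \<one> \<in> U \<and> (\<forall>c\<in>U. \<forall>d\<in>U. c \<sqinter> d \<in> U) \<and>
    (\<forall>c\<in>U. a \<sqinter> c \<noteq> b \<sqinter> c)}"
  have "{\<one>} \<in> F"
    using ab a b by (simp add: F_def central_one bounds op_closed)
  then have "\<exists>U\<in>F. \<forall>V\<in>F. U \<subseteq> V \<longrightarrow> V = U"
  proof (intro subset_Zorn_nonempty)
    fix C assume C: "C \<noteq> {}" "subset.chain F C"
    have sub: "C \<subseteq> F" and lin: "\<And>V W. \<lbrakk>V \<in> C; W \<in> C\<rbrakk> \<Longrightarrow> V \<subseteq> W \<or> W \<subseteq> V"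
      using C(2) by (auto simp: subset_chain_def)
    have "c \<sqinter> d \<in> \<Union>C" if "c \<in> V" "V \<in> C" "d \<in> W" "W \<in> C" for c d V W
      using lin[OF that(2,4)] that sub unfolding F_def by blast
    then show "\<Union>C \<in> F"
      using C(1) sub unfolding F_def by blast
  qed auto
  then obtain U where U: "U \<in> F" and max: "\<And>V. \<lbrakk>V \<in> F; U \<subseteq> V\<rbrakk> \<Longrightarrow> V = U"
    by blast
  have U': "U \<subseteq> central" "\<one> \<in> U" "\<And>c d. \<lbrakk>c \<in> U; d \<in> U\<rbrakk> \<Longrightarrow> c \<sqinter> d \<in> U"
    "\<And>c. c \<in> U \<Longrightarrow> a \<sqinter> c \<noteq> b \<sqinter> c"
    using U by (auto simp: F_def)
  have car: "c \<in> carrier L" if "c \<in> U" for c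
    using that U'(1) central_carrier by blast
  have extend: "\<exists>c\<in>U. a \<sqinter> (c \<sqinter> d) = b \<sqinter> (c \<sqinter> d)" if d: "d \<in> central" "d \<notin> U" for d
  proof (rule ccontr)
    assume contra: "\<not> ?thesis"
    have dc: "d \<in> carrier L" using d by (simp add: central_carrier)
    let ?V = "U \<union> (\<lambda>c. c \<sqinter> d) ` U"
    have "?V \<in> F"
    proof -
      have V_meet: "x \<sqinter> y \<in> ?V" if "x \<in> ?V" "y \<in> ?V" for x y
      proof -
        have *: "c \<sqinter> e \<sqinter> d \<in> (\<lambda>c. c \<sqinter> d) ` U" if "c \<in> U" "e \<in> U" for c e
          using U'(3)[OF that] by blast
        have eqs: "c \<sqinter> (e \<sqinter> d) = c \<sqinter> e \<sqinter> d" "c \<sqinter> d \<sqinter> e = c \<sqinter> e \<sqinter> d"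
          "c \<sqinter> d \<sqinter> (e \<sqinter> d) = c \<sqinter> e \<sqinter> d" if "c \<in> U" "e \<in> U" for c e
        proof -
          note k = car[OF that(1)] car[OF that(2)] dc
          show "c \<sqinter> (e \<sqinter> d) = c \<sqinter> e \<sqinter> d" using k by (simp add: meet_assoc)
          show 1: "c \<sqinter> d \<sqinter> e = c \<sqinter> e \<sqinter> d"
            using k by (simp add: meet_assoc meet_comm)
          have "c \<sqinter> d \<sqinter> (e \<sqinter> d) = c \<sqinter> d \<sqinter> e \<sqinter> d"
            using k by (simp add: meet_assoc op_closed)
          then show "c \<sqinter> d \<sqinter> (e \<sqinter> d) = c \<sqinter> e \<sqinter> d"
            unfolding 1 using k by (simp add: meet_assoc meet_idem op_closed)
        qed
        show ?thesis
          using that U'(3) * by (auto simp: eqs)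
      qed
      have "?V \<subseteq> central"
        using U'(1) d(1) central_meet by blast
      moreover have "a \<sqinter> x \<noteq> b \<sqinter> x" if "x \<in> ?V" for x
        using that U'(4) contra by blast
      ultimately show ?thesis
        unfolding F_def using U'(2) V_meet by blast
    qed
    then have "?V = U" using max by blast
    moreover have "\<one> \<sqinter> d \<in> ?V" using U'(2) by blast
    ultimately show False using d(2) dc by (simp add: bounds)
  qed
  have "c \<in> U \<or> c\<acute> \<in> U" if c: "c \<in> central" for c
  proof (rule ccontr)
    assume "\<not> (c \<in> U \<or> c\<acute> \<in> U)"
    then obtain d e where d: "d \<in> U" "a \<sqinter> (d \<sqinter> c) = b \<sqinter> (d \<sqinter> c)"
      and e: "e \<in> U" "a \<sqinter> (e \<sqinter> c\<acute>) = b \<sqinter> (e \<sqinter> c\<acute>)"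
      using extend[of c] extend[of "c\<acute>"] c central_inv by blast
    let ?f = "d \<sqinter> e"
    note k = a b car[OF d(1)] car[OF e(1)] central_carrier[OF c] op_closed
    have "a \<sqinter> ?f \<sqinter> c = a \<sqinter> (d \<sqinter> c) \<sqinter> e" "b \<sqinter> ?f \<sqinter> c = b \<sqinter> (d \<sqinter> c) \<sqinter> e"
      using k by (simp_all add: meet_assoc meet_comm[of e c])
    then have 1: "a \<sqinter> ?f \<sqinter> c = b \<sqinter> ?f \<sqinter> c" using d(2) by simp
    have "x \<sqinter> ?f \<sqinter> c\<acute> = x \<sqinter> (e \<sqinter> c\<acute>) \<sqinter> d" if x: "x \<in> carrier L" for x
    proof -
      have "x \<sqinter> ?f \<sqinter> c\<acute> = x \<sqinter> (d \<sqinter> (e \<sqinter> c\<acute>))" using x k by (simp add: meet_assoc)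
      also have "d \<sqinter> (e \<sqinter> c\<acute>) = (e \<sqinter> c\<acute>) \<sqinter> d" using k by (intro meet_comm) simp_all
      also have "x \<sqinter> \<dots> = x \<sqinter> (e \<sqinter> c\<acute>) \<sqinter> d" using x k by (intro meet_assoc[symmetric]) simp_all
      finally show ?thesis .
    qed
    then have 2: "a \<sqinter> ?f \<sqinter> c\<acute> = b \<sqinter> ?f \<sqinter> c\<acute>" using e(2) a b by simp
    have "(x \<sqinter> ?f \<sqinter> c) \<squnion> (x \<sqinter> ?f \<sqinter> c\<acute>) = x \<sqinter> ?f" if "x \<in> carrier L" for x
      by (rule central_split[OF _ c]) (simp add: that k)
    from this[OF a] this[OF b] have "a \<sqinter> ?f = b \<sqinter> ?f"
      unfolding 1 2 by simp
    with U'(4)[OF U'(3)[OF d(1) e(1)]] show False by simp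
  qed
  with U' show thesis by (rule that)
qed

text \<open>Identify \<open>x\<close> and \<open>y\<close> when \<open>x \<and> c = y \<and> c\<close> for some \<open>c\<close> in the ultrafilter. Meeting with a central element
commutes with the operations relative to that element (\<open>central_distrib\<close>, \<open>inv_meet_central\<close>,
\<open>brw_meet_central\<close>), so this is a congruence. A central element in the ultrafilter is identified
with \<open>1\<close>, one whose complement lies there with \<open>0\<close>.\<close>

lemma stalk_exists:
  assumes a: "a \<in> carrier L" and b: "b \<in> carrier L" and ab: "a \<noteq> b"
  obtains f :: "'a \<Rightarrow> 'a" where "f \<in> bz_hom L (bz_image f L)" "f a \<noteq> f b"
    "\<And>x. x \<in> carrier L \<Longrightarrow> f (x\<^sup>\<sim>) = f \<zero> \<or> f (x\<^sup>\<sim>) = f \<one>"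
proof -
  obtain U where U: "U \<subseteq> central" "\<one> \<in> U" and U_meet: "\<And>c d. \<lbrakk>c \<in> U; d \<in> U\<rbrakk> \<Longrightarrow> c \<sqinter> d \<in> U"
    and U_sep: "\<And>c. c \<in> U \<Longrightarrow> a \<sqinter> c \<noteq> b \<sqinter> c"
    and U_prime: "\<And>c. c \<in> central \<Longrightarrow> c \<in> U \<or> c\<acute> \<in> U"
    using separating_filter[OF a b ab] by blast
  have cen: "c \<in> central" and car: "c \<in> carrier L" if "c \<in> U" for c
    using that U(1) central_carrier by blast+
  define R where "R x y \<longleftrightarrow> (\<exists>c\<in>U. x \<sqinter> c = y \<sqinter> c)" for x y
  define f where "f x = (SOME y. y \<in> carrier L \<and> R x y)" for x
  have RI: "R x y" if "c \<in> U" "x \<sqinter> c = y \<sqinter> c" for c x y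
    using that by (auto simp: R_def)
  have common: "\<exists>c\<in>U. x \<sqinter> c = x' \<sqinter> c \<and> y \<sqinter> c = y' \<sqinter> c"
    if xy: "x \<in> carrier L" "x' \<in> carrier L" "y \<in> carrier L" "y' \<in> carrier L"
      and "R x x'" "R y y'" for x x' y y'
  proof -
    obtain c d where c: "c \<in> U" "x \<sqinter> c = x' \<sqinter> c" and d: "d \<in> U" "y \<sqinter> d = y' \<sqinter> d"
      using \<open>R x x'\<close> \<open>R y y'\<close> by (auto simp: R_def)
    have "z \<sqinter> (c \<sqinter> d) = z \<sqinter> c \<sqinter> d" "z \<sqinter> (c \<sqinter> d) = z \<sqinter> d \<sqinter> c" if "z \<in> carrier L" for z
      using that car[OF c(1)] car[OF d(1)] by (simp_all add: meet_assoc meet_comm[of c d])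
    then have "x \<sqinter> (c \<sqinter> d) = x' \<sqinter> (c \<sqinter> d)" "y \<sqinter> (c \<sqinter> d) = y' \<sqinter> (c \<sqinter> d)"
      using c(2) d(2) xy by metis+
    then show ?thesis using U_meet[OF c(1) d(1)] by blast
  qed
  have R_refl: "R x x" for x using U(2) by (auto simp: R_def)
  have R_sym: "R x y \<Longrightarrow> R y x" for x y by (auto simp: R_def intro: sym)
  have R_trans: "R x z" if "x \<in> carrier L" "y \<in> carrier L" "z \<in> carrier L" "R x y" "R y z" for x y z
    using common[of x y y z] that by (auto simp: R_def)
  have f: "f x \<in> carrier L" "R x (f x)" if "x \<in> carrier L" for x
    using someI[where P = "\<lambda>y. y \<in> carrier L \<and> R x y" and x = x] that R_refl
    unfolding f_def by blast+
  have f_iff: "f x = f y \<longleftrightarrow> R x y" if xy: "x \<in> carrier L" "y \<in> carrier L" for x y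
  proof
    assume "R x y"
    then have "(z \<in> carrier L \<and> R x z) = (z \<in> carrier L \<and> R y z)" for z
      using R_trans R_sym xy by blast
    then show "f x = f y" by (simp add: f_def)
  next
    assume "f x = f y"
    then show "R x y" using R_trans[of x "f x" y] f[OF xy(1)] f[OF xy(2)] R_sym xy by metis
  qed
  have "f \<in> bi_hom L (bi_image f L)"
  proof (rule bi_image_hom)
    fix x x' y y'
    assume xy: "x \<in> carrier L" "x' \<in> carrier L" "y \<in> carrier L" "y' \<in> carrier L"
      and "f x = f x'" "f y = f y'"
    then obtain c where c: "c \<in> U" "x \<sqinter> c = x' \<sqinter> c" "y \<sqinter> c = y' \<sqinter> c"
      using common f_iff by blast
    have "z \<sqinter> w \<sqinter> c = (z \<sqinter> c) \<sqinter> (w \<sqinter> c)" if "z \<in> carrier L" "w \<in> carrier L" for z w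
    proof -
      note k = that car[OF c(1)] op_closed
      have "c \<sqinter> (w \<sqinter> c) = w \<sqinter> c"
        using meet_le2[of w c] meet_comm[of c "w \<sqinter> c"] k by (simp add: bi_le_def)
      then have "z \<sqinter> (c \<sqinter> (w \<sqinter> c)) = z \<sqinter> (w \<sqinter> c)" by simp
      then show ?thesis using k by (simp add: meet_assoc)
    qed
    then have "x \<sqinter> y \<sqinter> c = x' \<sqinter> y' \<sqinter> c"
      using xy c by simp
    then show "f (x \<sqinter> y) = f (x' \<sqinter> y')"
      using xy c(1) by (simp add: f_iff op_closed RI)
    have "(x \<squnion> y) \<sqinter> c = (x' \<squnion> y') \<sqinter> c"
      using xy c(2,3) cen[OF c(1)] by (simp add: central_distrib)
    then show "f (x \<squnion> y) = f (x' \<squnion> y')"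
      using xy c(1) by (simp add: f_iff op_closed RI)
  next
    fix x x' assume x: "x \<in> carrier L" "x' \<in> carrier L" and "f x = f x'"
    then obtain c where c: "c \<in> U" "x \<sqinter> c = x' \<sqinter> c"
      using f_iff by (auto simp: R_def)
    then have "x\<acute> \<sqinter> c = x'\<acute> \<sqinter> c"
      using inv_meet_central[OF _ cen] x by metis
    then show "f (x\<acute>) = f (x'\<acute>)"
      using x c(1) by (simp add: f_iff op_closed RI)
  qed
  then have "f \<in> bz_hom L (bz_image f L)"
  proof (rule bz_image_hom)
    fix x x' assume x: "x \<in> carrier L" "x' \<in> carrier L" and "f x = f x'"
    then obtain c where c: "c \<in> U" "x \<sqinter> c = x' \<sqinter> c"
      using f_iff by (auto simp: R_def)
    then have "x\<^sup>\<sim> \<sqinter> c = x'\<^sup>\<sim> \<sqinter> c"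
      using brw_meet_central[OF _ cen] x by metis
    then show "f (x\<^sup>\<sim>) = f (x'\<^sup>\<sim>)"
      using x c(1) by (simp add: f_iff op_closed RI)
  qed
  moreover have "f a \<noteq> f b"
    using U_sep by (auto simp: f_iff a b R_def)
  moreover have "f (x\<^sup>\<sim>) = f \<zero> \<or> f (x\<^sup>\<sim>) = f \<one>" if x: "x \<in> carrier L" for x
  proof -
    have xs: "x\<^sup>\<sim> \<in> central" "x\<^sup>\<sim> \<in> carrier L" using x by (simp_all add: central_brw op_closed)
    have "R (x\<^sup>\<sim>) \<one>" if "x\<^sup>\<sim> \<in> U"
      by (rule RI[OF that]) (simp add: xs bounds meet_idem)
    moreover have "R (x\<^sup>\<sim>) \<zero>" if "x\<^sup>\<sim>\<acute> \<in> U"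
      by (rule RI[OF that]) (simp add: xs bounds op_closed central_meet_inv)
    ultimately show ?thesis
      using U_prime[OF xs(1)] by (auto simp: f_iff xs op_closed)
  qed
  ultimately show thesis using that by blast
qed

end

lemma (in bz_lattice) j0_latticeI: "L \<Turnstile>\<^sub>B\<^sub>Z J0 \<Longrightarrow> j0_lattice L"
  by unfold_locales (simp add: J0_sat_iff)

lemma pbz_star_equational:
  assumes A: "pbz_star_lattice A" "A \<Turnstile>\<^sub>B\<^sub>Z J0" and B: "bz_closed B"
    and sat: "\<And>p :: nat bz_term \<times> nat bz_term. A \<Turnstile>\<^sub>B\<^sub>Z p \<Longrightarrow> B \<Turnstile>\<^sub>B\<^sub>Z p"
  shows "pbz_star_lattice B"
proof -
  interpret A: pbz_star_lattice A by (rule A)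
  interpret B: bz_lattice B
    using bz_lattice_equational[OF A.bz_lattice_axioms B] sat by blast
  interpret B: j0_lattice B
    using B.j0_latticeI sat[OF A(2)] by blast
  have "(x \<sqinter>\<^bsub>B\<^esub> x\<acute>\<^bsub>B\<^esub>)\<^sup>\<sim>\<^bsub>B\<^esub> = x\<^sup>\<sim>\<^bsub>B\<^esub> \<squnion>\<^bsub>B\<^esub> x\<acute>\<^bsub>B\<^esub>\<^sup>\<sim>\<^bsub>B\<^esub>" if x: "x \<in> carrier B" for x
    using bz_sat_val3[OF sat, of "Brw (Meet (Var 0) (Inv (Var 0)))"
        "Join (Brw (Var 0)) (Brw (Inv (Var 0)))", OF _ x x x]
    by (simp add: bz_sat_def val3_def A.star)
  then show ?thesis by (rule B.pbz_starI)
qed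

section \<open>The shape of the stalks\<close>

text \<open>As \<open>x\<^sup>\<sim> = 0\<close> for \<open>x \<noteq> 0\<close>, the star condition shows that only \<open>0\<close> and \<open>1\<close> satisfy \<open>x \<and> x' = 0\<close>. For
\<open>x, y \<notin> {0, 1}\<close> the first two joinands of D2OL\<open>\<or>\<close> vanish, and \<open>x \<or> x' = y \<or> y' =: t\<close> remains. So the
elements other than \<open>0\<close> and \<open>1\<close>, if there are any, form the interval from \<open>t'\<close> to \<open>t\<close>, in which \<open>'\<close> is an
orthocomplementation. If there are none, the algebra embeds into every \<open>D2_sum N\<close> as the set of
its two bounds.\<close>

lemma trivial_brw_cases:
  fixes Q :: "'a bz_alg" and N :: "'b bi_alg"
  assumes Q: "pbz_star_lattice Q" and D2OL: "Q \<Turnstile>\<^sub>B\<^sub>Z D2OL_join" and nontriv: "\<zero>\<^bsub>Q\<^esub> \<noteq> \<one>\<^bsub>Q\<^esub>"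
    and triv: "\<And>x. x \<in> carrier Q \<Longrightarrow> x\<^sup>\<sim>\<^bsub>Q\<^esub> = \<zero>\<^bsub>Q\<^esub> \<or> x\<^sup>\<sim>\<^bsub>Q\<^esub> = \<one>\<^bsub>Q\<^esub>"
  obtains (two) h where "h \<in> bz_hom Q (D2_sum N)" "inj_on h (carrier Q)"
    | (sum) M h where "ortholattice (M :: 'a bi_alg)" "h \<in> bz_hom (D2_sum M) Q"
      "inj_on h (carrier (D2_sum M))" "h ` carrier (D2_sum M) = carrier Q"
proof -
  interpret pbz_star_lattice Q by (rule Q)
  note [simp] = op_closed
  have brw0: "x\<^sup>\<sim>\<^bsub>Q\<^esub> = \<zero>\<^bsub>Q\<^esub>" if "x \<in> carrier Q" "x \<noteq> \<zero>\<^bsub>Q\<^esub>" for x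
    using triv[OF that(1)] meet_brw[OF that(1)] that bounds(4)[OF that(1)] by auto
  define C where "C = carrier Q - {\<zero>\<^bsub>Q\<^esub>, \<one>\<^bsub>Q\<^esub>}"
  have CQ: "x \<in> carrier Q" if "x \<in> C" for x using that by (simp add: C_def)
  have inv_C: "x\<acute>\<^bsub>Q\<^esub> \<in> C" if "x \<in> C" for x
    using that inv_involutive[of x] zero_inv one_inv by (auto simp: C_def)
  have unsharp: "x \<sqinter>\<^bsub>Q\<^esub> x\<acute>\<^bsub>Q\<^esub> \<noteq> \<zero>\<^bsub>Q\<^esub>" if "x \<in> C" for x
    using star[of x] brw0[of x] brw0[of "x\<acute>\<^bsub>Q\<^esub>"] that inv_C[OF that] nontriv zero_brw
    by (auto simp: C_def bounds)
  have top: "x \<squnion>\<^bsub>Q\<^esub> x\<acute>\<^bsub>Q\<^esub> = y \<squnion>\<^bsub>Q\<^esub> y\<acute>\<^bsub>Q\<^esub>" if "x \<in> C" "y \<in> C" for x y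
    using D2OL[unfolded D2OL_sat_iff, rule_format, of x y] brw0[OF _ unsharp, of x] brw0[OF _ unsharp, of y]
      that CQ by (simp add: bounds)
  show thesis
  proof (cases "C = {}")
    case True
    then have car: "carrier Q = {\<zero>\<^bsub>Q\<^esub>, \<one>\<^bsub>Q\<^esub>}"
      using zero_closed one_closed by (auto simp: C_def)
    define h :: "'a \<Rightarrow> 'b d2_ext" where "h x = (if x = \<zero>\<^bsub>Q\<^esub> then Bot else Top)" for x
    have one_brw: "\<one>\<^bsub>Q\<^esub>\<^sup>\<sim>\<^bsub>Q\<^esub> = \<zero>\<^bsub>Q\<^esub>" using brw0[of "\<one>\<^bsub>Q\<^esub>"] nontriv by simp
    have "h \<in> bz_hom Q (D2_sum N)"
      unfolding bz_hom_def bi_hom_def car using nontriv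
      by (auto simp: h_def D2_sum_def bounds zero_inv one_inv zero_brw one_brw)
    moreover have "inj_on h (carrier Q)"
      unfolding car using nontriv by (auto simp: h_def inj_on_def)
    ultimately show thesis by (rule two)
  next
    case False
    then obtain m where m: "m \<in> C" by blast
    define t where "t = m \<squnion>\<^bsub>Q\<^esub> m\<acute>\<^bsub>Q\<^esub>"
    define b where "b = t\<acute>\<^bsub>Q\<^esub>"
    have [simp]: "t \<in> carrier Q" "b \<in> carrier Q" using CQ[OF m] by (simp_all add: t_def b_def)
    have join: "x \<squnion>\<^bsub>Q\<^esub> x\<acute>\<^bsub>Q\<^esub> = t" if "x \<in> C" for x
      using top[OF that m] by (simp add: t_def)
    have meet: "x \<sqinter>\<^bsub>Q\<^esub> x\<acute>\<^bsub>Q\<^esub> = b" if "x \<in> C" for x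
      using join[OF that] CQ[OF that]
      by (simp add: b_def join_inv_eq inv_involutive meet_comm[of "x\<acute>\<^bsub>Q\<^esub>"] flip: join[OF that])
    have b0: "b \<noteq> \<zero>\<^bsub>Q\<^esub>" using meet[OF m] unsharp[OF m] by simp
    have t1: "t \<noteq> \<one>\<^bsub>Q\<^esub>" using b0 one_inv by (auto simp: b_def)
    have C_iff: "x \<in> C \<longleftrightarrow> x \<in> carrier Q \<and> b \<sqsubseteq>\<^bsub>Q\<^esub> x \<and> x \<sqsubseteq>\<^bsub>Q\<^esub> t" for x
    proof
      assume x: "x \<in> C"
      show "x \<in> carrier Q \<and> b \<sqsubseteq>\<^bsub>Q\<^esub> x \<and> x \<sqsubseteq>\<^bsub>Q\<^esub> t"
        using CQ[OF x] meet_le1[of x "x\<acute>\<^bsub>Q\<^esub>"] join_ge1[of x "x\<acute>\<^bsub>Q\<^esub>"] meet[OF x] join[OF x] by simp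
    next
      assume x: "x \<in> carrier Q \<and> b \<sqsubseteq>\<^bsub>Q\<^esub> x \<and> x \<sqsubseteq>\<^bsub>Q\<^esub> t"
      have "x \<noteq> \<zero>\<^bsub>Q\<^esub>" using x b0 by (auto simp: bi_le_def bounds)
      moreover have "x \<noteq> \<one>\<^bsub>Q\<^esub>" using x t1 by (auto simp: bi_le_def bounds)
      ultimately show "x \<in> C" using x by (simp add: C_def)
    qed
    have b_le_t: "b \<sqsubseteq>\<^bsub>Q\<^esub> t"
      using m le_trans[of b m t] by (simp add: C_iff)
    have meet_C: "x \<sqinter>\<^bsub>Q\<^esub> y \<in> C" and join_C: "x \<squnion>\<^bsub>Q\<^esub> y \<in> C" if "x \<in> C" "y \<in> C" for x y
      using that by (simp_all add: C_iff meet_greatest join_least meet_le_trans1 le_join_trans1)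
    have bt_C: "b \<in> C" "t \<in> C"
      using b_le_t by (simp_all add: C_iff le_refl)
    define M where "M = \<lparr>carrier = C, bi_meet = bi_meet Q, bi_join = bi_join Q, bi_inv = bi_inv Q,
      bi_zero = b, bi_one = t\<rparr>"
    have M: "ortholattice M"
    proof
      fix x y z assume "x \<in> carrier M" "y \<in> carrier M" "z \<in> carrier M"
      then show "(x \<sqinter>\<^bsub>M\<^esub> y) \<sqinter>\<^bsub>M\<^esub> z = x \<sqinter>\<^bsub>M\<^esub> (y \<sqinter>\<^bsub>M\<^esub> z)"
        "(x \<squnion>\<^bsub>M\<^esub> y) \<squnion>\<^bsub>M\<^esub> z = x \<squnion>\<^bsub>M\<^esub> (y \<squnion>\<^bsub>M\<^esub> z)"
        by (simp_all add: M_def CQ meet_assoc join_assoc)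
    next
      fix x y assume "x \<in> carrier M" "y \<in> carrier M"
      then show "x \<sqinter>\<^bsub>M\<^esub> y = y \<sqinter>\<^bsub>M\<^esub> x" "x \<squnion>\<^bsub>M\<^esub> y = y \<squnion>\<^bsub>M\<^esub> x"
        by (simp_all add: M_def CQ meet_comm join_comm)
    next
      fix x y assume "x \<in> carrier M" "y \<in> carrier M" "x \<sqsubseteq>\<^bsub>M\<^esub> y"
      then show "y\<acute>\<^bsub>M\<^esub> \<sqsubseteq>\<^bsub>M\<^esub> x\<acute>\<^bsub>M\<^esub>"
        using inv_antitone[of x y] by (simp add: M_def CQ bi_le_def)
    next
      fix x assume "x \<in> carrier M"
      then have x: "x \<in> C" by (simp add: M_def)
      then show "\<zero>\<^bsub>M\<^esub> \<sqsubseteq>\<^bsub>M\<^esub> x" "x \<sqsubseteq>\<^bsub>M\<^esub> \<one>\<^bsub>M\<^esub>"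
        by (simp_all add: M_def bi_le_def C_iff)
      show "x \<squnion>\<^bsub>M\<^esub> x\<acute>\<^bsub>M\<^esub> = \<one>\<^bsub>M\<^esub>"
        using join[OF x] by (simp add: M_def)
    qed (simp_all add: M_def CQ meet_C join_C inv_C bt_C meet_absorb join_absorb inv_involutive)
    define h where "h x = (case x of Bot \<Rightarrow> \<zero>\<^bsub>Q\<^esub> | Mid x \<Rightarrow> x | Top \<Rightarrow> \<one>\<^bsub>Q\<^esub>)" for x
    have C0: "x \<noteq> \<zero>\<^bsub>Q\<^esub>" "x \<noteq> \<one>\<^bsub>Q\<^esub>" if "x \<in> C" for x using that by (auto simp: C_def)
    have one_brw: "\<one>\<^bsub>Q\<^esub>\<^sup>\<sim>\<^bsub>Q\<^esub> = \<zero>\<^bsub>Q\<^esub>" using brw0[of "\<one>\<^bsub>Q\<^esub>"] nontriv by simp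
    have "h \<in> bz_hom (D2_sum M) Q"
      unfolding bz_hom_def bi_hom_def
      by (auto simp: h_def D2_sum_def M_def CQ C0 brw0 bounds zero_inv one_inv zero_brw one_brw)
    moreover have "inj_on h (carrier (D2_sum M))"
      using nontriv C0 by (auto simp: inj_on_def h_def D2_sum_def M_def)
    moreover have "h ` carrier (D2_sum M) = carrier Q"
      by (auto simp: image_Un image_image h_def D2_sum_def M_def C_def)
    ultimately show thesis by (rule sum[OF M])
  qed
qed

text \<open>A failure of \<open>q\<close> in \<open>L\<close> consists of two different elements, which some stalk keeps apart; so \<open>q\<close> fails in
that stalk, which is of one of the two shapes of \<open>trivial_brw_cases\<close>. The algebra \<open>N\<close> covers
two-element stalks.\<close>

lemma sat_by_stalks:
  fixes L :: "'a bz_alg" and q :: "'v bz_term \<times> 'v bz_term" and N :: "'b bi_alg"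
  assumes L: "pbz_star_lattice L" "L \<Turnstile>\<^sub>B\<^sub>Z J0" "L \<Turnstile>\<^sub>B\<^sub>Z D2OL_join" and N: "D2_sum N \<Turnstile>\<^sub>B\<^sub>Z q"
    and stalk: "\<And>M :: 'a bi_alg. \<lbrakk>ortholattice M;
        \<And>p :: nat bz_term \<times> nat bz_term. L \<Turnstile>\<^sub>B\<^sub>Z p \<Longrightarrow> D2_sum M \<Turnstile>\<^sub>B\<^sub>Z p\<rbrakk> \<Longrightarrow> D2_sum M \<Turnstile>\<^sub>B\<^sub>Z q"
  shows "L \<Turnstile>\<^sub>B\<^sub>Z q"
proof (rule ccontr)
  interpret L: pbz_star_lattice L by (rule L)
  interpret L: j0_lattice L by (rule L.j0_latticeI) (rule L)
  assume "\<not> L \<Turnstile>\<^sub>B\<^sub>Z q"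
  then obtain e where e: "\<And>v. e v \<in> carrier L" and ne: "bz_eval L e (fst q) \<noteq> bz_eval L e (snd q)"
    by (auto simp: bz_sat_def)
  obtain f :: "'a \<Rightarrow> 'a" where f: "f \<in> bz_hom L (bz_image f L)"
    and sep: "f (bz_eval L e (fst q)) \<noteq> f (bz_eval L e (snd q))"
    and triv: "\<And>x. x \<in> carrier L \<Longrightarrow> f (x\<^sup>\<sim>\<^bsub>L\<^esub>) = f \<zero>\<^bsub>L\<^esub> \<or> f (x\<^sup>\<sim>\<^bsub>L\<^esub>) = f \<one>\<^bsub>L\<^esub>"
    using L.stalk_exists[OF _ _ ne] bz_eval_closed[OF L.bz_closed, of e, OF e] by blast
  define Q where "Q = bz_image f L"
  have fQ: "f \<in> bz_hom L Q" "f ` carrier L = carrier Q" using f by (simp_all add: Q_def)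
  have not_q: "\<not> Q \<Turnstile>\<^sub>B\<^sub>Z q"
  proof
    assume "Q \<Turnstile>\<^sub>B\<^sub>Z q"
    moreover have "\<forall>v. f (e v) \<in> carrier Q" using e fQ(2) by blast
    ultimately have "bz_eval Q (\<lambda>v. f (e v)) (fst q) = bz_eval Q (\<lambda>v. f (e v)) (snd q)"
      by (simp add: bz_sat_def)
    then show False using sep by (simp add: bz_hom_eval[OF L.bz_closed fQ(1) e])
  qed
  have LQ: "Q \<Turnstile>\<^sub>B\<^sub>Z p" if "L \<Turnstile>\<^sub>B\<^sub>Z p" for p :: "nat bz_term \<times> nat bz_term"
    by (rule bz_sat_image[OF L.bz_closed fQ that])
  have Q: "pbz_star_lattice Q"
    by (rule pbz_star_equational[OF L(1,2) bz_closed_image[OF L.bz_closed fQ] LQ])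
  interpret Q: pbz_star_lattice Q by (rule Q)
  have f01: "f \<zero>\<^bsub>L\<^esub> = \<zero>\<^bsub>Q\<^esub>" "f \<one>\<^bsub>L\<^esub> = \<one>\<^bsub>Q\<^esub>"
    and f_brw: "\<And>x. x \<in> carrier L \<Longrightarrow> f (x\<^sup>\<sim>\<^bsub>L\<^esub>) = (f x)\<^sup>\<sim>\<^bsub>Q\<^esub>"
    using fQ(1) by (auto simp: bz_hom_def bi_hom_def)
  have triv_Q: "x\<^sup>\<sim>\<^bsub>Q\<^esub> = \<zero>\<^bsub>Q\<^esub> \<or> x\<^sup>\<sim>\<^bsub>Q\<^esub> = \<one>\<^bsub>Q\<^esub>" if "x \<in> carrier Q" for x
    using that triv by (auto simp: f01 f_brw simp flip: fQ(2))
  have nontriv: "\<zero>\<^bsub>Q\<^esub> \<noteq> \<one>\<^bsub>Q\<^esub>"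
  proof
    assume eq: "\<zero>\<^bsub>Q\<^esub> = \<one>\<^bsub>Q\<^esub>"
    have "x = \<zero>\<^bsub>Q\<^esub>" if "x \<in> carrier Q" for x
      using Q.bounds(2,4)[OF that] eq by simp
    then have "Q \<Turnstile>\<^sub>B\<^sub>Z q"
      using bz_eval_closed[OF Q.bz_closed] unfolding bz_sat_def by metis
    then show False using not_q by simp
  qed
  show False
  proof (rule trivial_brw_cases[OF Q LQ[OF L(3)] nontriv triv_Q, where N = N])
    fix h assume "h \<in> bz_hom Q (D2_sum N)" "inj_on h (carrier Q)"
    then show False
      using bz_sat_embedding[OF Q.bz_closed _ _ N] not_q by blast
  next
    fix M :: "'a bi_alg" and h
    assume M: "ortholattice M" and h: "h \<in> bz_hom (D2_sum M) Q" "inj_on h (carrier (D2_sum M))"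
      "h ` carrier (D2_sum M) = carrier Q"
    interpret M: ortholattice M by (rule M)
    have cM: "bz_closed (D2_sum M)" by (rule D2_sum_closed[OF M.bi_closed])
    have "D2_sum M \<Turnstile>\<^sub>B\<^sub>Z q"
      by (rule stalk[OF M]) (rule bz_sat_embedding[OF cM h(1,2) LQ])
    then have "Q \<Turnstile>\<^sub>B\<^sub>Z q" by (rule bz_sat_image[OF cM h(1,3)])
    then show False using not_q by simp
  qed auto
qed

section \<open>Copies inside an infinite type\<close>

text \<open>Two elements are freed for the bounds by shifting a sequence \<open>g\<close> of distinct elements by two places.\<close>

lemma inj_d2_ext: "\<exists>f :: 'a::infinite d2_ext \<Rightarrow> 'a. inj f"
proof -
  obtain g :: "nat \<Rightarrow> 'a" where g: "inj g"
    using infinite_countable_subset[OF infinite_UNIV] by blast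
  define f where "f x = (case x of Bot \<Rightarrow> g 0 | Top \<Rightarrow> g 1
    | Mid a \<Rightarrow> if a \<in> range g then g (inv g a + 2) else a)" for x
  have "inj f"
  proof (rule injI)
    fix x y assume "f x = f y"
    then show "x = y"
      by (auto simp: f_def inj_eq[OF g] inv_f_f[OF g] split: d2_ext.splits if_splits)
  qed
  then show ?thesis by blast
qed

lemma inj_b6: "\<exists>f :: b6 \<Rightarrow> 'a::infinite. inj f"
proof -
  obtain g :: "nat \<Rightarrow> 'a" where g: "inj g"
    using infinite_countable_subset[OF infinite_UNIV] by blast
  define k :: "b6 \<Rightarrow> nat" where
    "k x = (case x of b6_0 \<Rightarrow> 0 | b6_a \<Rightarrow> 1 | b6_b \<Rightarrow> 2 | b6_a' \<Rightarrow> 3 | b6_b' \<Rightarrow> 4 | b6_1 \<Rightarrow> 5)" for x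
  have "inj k"
  proof (rule injI)
    fix x y assume "k x = k y"
    then show "x = y" by (cases x; cases y) (simp_all add: k_def)
  qed
  then show ?thesis using inj_compose[OF g] by blast
qed

section \<open>Terms without constants\<close>

text \<open>If \<open>s\<close> reduced to a bound, then it would be equivalent to a constant.\<close>

lemma bound_normal_Mid:
  fixes s :: "'v bi_term"
  assumes "\<And>c :: 'v bi_term. bi_vars c = {} \<Longrightarrow> \<exists>L :: 'a bi_alg. bi_lattice L \<and> \<not> L \<Turnstile>\<^sub>B\<^sub>I (s, c)"
  shows "\<exists>s'. bound_normal s = Mid s'"
proof (cases "bound_normal s")
  case Bot
  then have "L \<Turnstile>\<^sub>B\<^sub>I (s, BIZero)" if "bi_lattice L" for L :: "'a bi_alg"
    using bi_eval_bound_normal[OF that, of _ s] by (simp add: bi_sat_def)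
  then show ?thesis using assms[of BIZero] by auto
next
  case Top
  then have "L \<Turnstile>\<^sub>B\<^sub>I (s, BIOne)" if "bi_lattice L" for L :: "'a bi_alg"
    using bi_eval_bound_normal[OF that, of _ s] by (simp add: bi_sat_def)
  then show ?thesis using assms[of BIOne] by auto
qed auto

primrec elim_const :: "'v \<Rightarrow> 'v bi_term \<Rightarrow> 'v bi_term" where
  "elim_const v (BIVar x) = BIVar x"
| "elim_const v BIZero = BIMeet (BIVar v) (BIInv (BIVar v))"
| "elim_const v BIOne = BIJoin (BIVar v) (BIInv (BIVar v))"
| "elim_const v (BIInv t) = BIInv (elim_const v t)"
| "elim_const v (BIMeet s t) = BIMeet (elim_const v s) (elim_const v t)"
| "elim_const v (BIJoin s t) = BIJoin (elim_const v s) (elim_const v t)"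

lemma (in ortholattice) bi_eval_elim_const:
  "e v \<in> carrier L \<Longrightarrow> bi_eval L e (elim_const v t) = bi_eval L e t"
  by (induction t) (simp_all add: meet_inv join_inv)

lemma (in ortholattice) sat_elim_const:
  "L \<Turnstile>\<^sub>B\<^sub>I (elim_const v s, elim_const v t) \<longleftrightarrow> L \<Turnstile>\<^sub>B\<^sub>I (s, t)"
  by (simp add: bi_sat_def bi_eval_elim_const)

lemma bound_normal_elim_const: "bound_normal (elim_const v t) = Mid (elim_const v t)"
  by (induction t) (simp_all add: bound_normal_def D2_sum_def term_alg_def)

text \<open>Once \<open>elim_const\<close> has removed the constants, the guarded equation expresses in \<open>D2_sum M\<close> that the given
equation holds in \<open>M\<close>.\<close>

lemma D2_sum_sat_reflect:
  fixes p :: "'v bi_term \<times> 'v bi_term"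
  assumes N: "ortholattice N" and M: "ortholattice M"
    and sat: "\<And>q :: 'v bz_term \<times> 'v bz_term. D2_sum N \<Turnstile>\<^sub>B\<^sub>Z q \<Longrightarrow> D2_sum M \<Turnstile>\<^sub>B\<^sub>Z q"
    and p: "N \<Turnstile>\<^sub>B\<^sub>I p"
  shows "M \<Turnstile>\<^sub>B\<^sub>I p"
proof -
  interpret N: ortholattice N by (rule N)
  interpret M: ortholattice M by (rule M)
  obtain s t where st: "p = (s, t)" by fastforce
  \<comment> \<open>Any variable serves to express the constants.\<close>
  define v :: 'v where "v = undefined"
  let ?s = "elim_const v s" and ?t = "elim_const v t"
  obtain vs where vs: "set vs = bi_vars ?s \<union> bi_vars ?t"
    using finite_list[of "bi_vars ?s \<union> bi_vars ?t"] by (auto simp: finite_bi_vars)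
  have vars: "bi_vars ?s \<union> bi_vars ?t \<subseteq> set vs" by (simp add: vs)
  note iff = guarded_sat_iff[OF _ bound_normal_elim_const bound_normal_elim_const vars]
  have "N \<Turnstile>\<^sub>B\<^sub>I (?s, ?t)" using p by (simp add: N.sat_elim_const st)
  then have "D2_sum N \<Turnstile>\<^sub>B\<^sub>Z (guarded vs (bz_of_bi ?s), guarded vs (bz_of_bi ?t))"
    by (simp add: iff[OF N.bi_lattice_axioms])
  then have "D2_sum M \<Turnstile>\<^sub>B\<^sub>Z (guarded vs (bz_of_bi ?s), guarded vs (bz_of_bi ?t))" by (rule sat)
  then have "M \<Turnstile>\<^sub>B\<^sub>I (?s, ?t)"
    by (simp add: iff[OF M.bi_lattice_axioms])
  then show ?thesis by (simp add: M.sat_elim_const st)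
qed

section \<open>The axiomatisation\<close>

theorem corollary10:
  fixes I :: "'i set" and t u :: "'i \<Rightarrow> nat bi_term"
  assumes nonzero_arity: "\<And>i. i \<in> I \<Longrightarrow> bi_vars (t i) \<noteq> {} \<and> bi_vars (u i) \<noteq> {}"
    and not_nullary: "\<And>i c. i \<in> I \<Longrightarrow> bi_vars c = {} \<Longrightarrow>
          (\<exists>L :: 'a::infinite bi_alg. bi_lattice L \<and> \<not> L \<Turnstile>\<^sub>B\<^sub>I (t i, c)) \<and>
          (\<exists>L :: 'a bi_alg. bi_lattice L \<and> \<not> L \<Turnstile>\<^sub>B\<^sub>I (u i, c))"
  shows "(bi_variety B6 :: 'a bi_alg set) =
           {L. ortholattice L \<and> (\<forall>i\<in>I. L \<Turnstile>\<^sub>B\<^sub>I (t i, u i))}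
         \<longleftrightarrow>
         (bz_variety F8 :: 'a bz_alg set) =
           {L. pbz_star_lattice L \<and> (\<forall>i\<in>I. L \<Turnstile>\<^sub>B\<^sub>Z m_equation (t i) (u i)) \<and>
               L \<Turnstile>\<^sub>B\<^sub>Z J0 \<and> L \<Turnstile>\<^sub>B\<^sub>Z D2OL_join}"
    (is "?VB = ?OL \<longleftrightarrow> ?VF = ?PBZ")
proof -
  interpret B6: ortholattice B6 by (rule B6_ortholattice)
  interpret F8: pbz_star_lattice F8 unfolding F8_def by (rule B6.D2_sum_pbz_star)
  have F8_J0: "F8 \<Turnstile>\<^sub>B\<^sub>Z J0" and F8_D2OL: "F8 \<Turnstile>\<^sub>B\<^sub>Z D2OL_join"
    unfolding F8_def by (rule B6.D2_sum_J0 B6.D2_sum_D2OL)+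
  have m_iff: "D2_sum M \<Turnstile>\<^sub>B\<^sub>Z m_equation (t i) (u i) \<longleftrightarrow> M \<Turnstile>\<^sub>B\<^sub>I (t i, u i)"
    if i: "i \<in> I" and M: "bi_lattice M" for i and M :: "'b bi_alg"
  proof -
    have "\<exists>t'. bound_normal (t i) = Mid t'" "\<exists>u'. bound_normal (u i) = Mid u'"
      using not_nullary[OF i] by (simp_all add: bound_normal_Mid[where 'a = 'a])
    then show ?thesis using D2_sum_m_equation_iff[OF M] by fast
  qed
  have VB_ortho: "ortholattice L" if "L \<in> ?VB" for L
    using ortholattice_equational[OF B6_ortholattice] bi_variety_dest[OF that] by blast
  have VF_pbz: "pbz_star_lattice L \<and> L \<Turnstile>\<^sub>B\<^sub>Z J0 \<and> L \<Turnstile>\<^sub>B\<^sub>Z D2OL_join" if "L \<in> ?VF" for L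
    using pbz_star_equational[OF F8.pbz_star_lattice_axioms F8_J0] bz_variety_dest[OF that]
      F8_J0 F8_D2OL by blast
  obtain k :: "b6 \<Rightarrow> 'a" where k: "inj k" using inj_b6 by blast
  obtain f :: "'a d2_ext \<Rightarrow> 'a" where f: "inj f" using inj_d2_ext by blast
  show ?thesis
  proof
    assume VB: "?VB = ?OL"
    have k_hom: "k \<in> bi_hom B6 (bi_image k B6)"
      by (rule bi_image_inj_hom) (rule inj_on_subset[OF k subset_UNIV])
    have "bi_image k B6 \<in> ?VB"
      by (rule bi_birkhoff[OF B6.bi_closed bi_closed_image[OF B6.bi_closed k_hom]])
        (auto intro: bi_sat_image[OF B6.bi_closed k_hom])
    then have B6_sat: "B6 \<Turnstile>\<^sub>B\<^sub>I (t i, u i)" if "i \<in> I" for i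
      using VB that
      by (intro bi_sat_embedding[OF B6.bi_closed k_hom inj_on_subset[OF k subset_UNIV]]) blast
    show "?VF = ?PBZ"
    proof (intro equalityI subsetI)
      fix L assume L: "L \<in> ?VF"
      have "L \<Turnstile>\<^sub>B\<^sub>Z m_equation (t i) (u i)" if "i \<in> I" for i
        using bz_variety_dest(2)[OF L] m_iff[OF that B6.bi_lattice_axioms] B6_sat[OF that]
        by (simp add: F8_def)
      then show "L \<in> ?PBZ" using VF_pbz[OF L] by blast
    next
      fix L assume L: "L \<in> ?PBZ"
      then interpret L: pbz_star_lattice L by blast
      show "L \<in> ?VF"
      proof (rule bz_birkhoff[OF F8.bz_closed L.bz_closed])
        fix q :: "'a bz_term \<times> 'a bz_term" assume "F8 \<Turnstile>\<^sub>B\<^sub>Z q"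
        then have q: "D2_sum B6 \<Turnstile>\<^sub>B\<^sub>Z q" by (simp add: F8_def)
        show "L \<Turnstile>\<^sub>B\<^sub>Z q"
        proof (rule sat_by_stalks[OF L.pbz_star_lattice_axioms _ _ q])
          fix M :: "'a bi_alg"
          assume M: "ortholattice M"
            and sat: "\<And>p :: nat bz_term \<times> nat bz_term. L \<Turnstile>\<^sub>B\<^sub>Z p \<Longrightarrow> D2_sum M \<Turnstile>\<^sub>B\<^sub>Z p"
          interpret M: ortholattice M by (rule M)
          have "M \<Turnstile>\<^sub>B\<^sub>I (t i, u i)" if "i \<in> I" for i
            using sat L that m_iff[OF that M.bi_lattice_axioms] by blast
          then have "M \<in> ?VB" using VB M by blast
          then show "D2_sum M \<Turnstile>\<^sub>B\<^sub>Z q"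
            using D2_sum_sat_mono[OF B6.bi_closed M.bi_closed _ q] bi_variety_dest(2) by blast
        qed (use L in blast)+
      qed
    qed
  next
    assume VF: "?VF = ?PBZ"
    define k' where "k' = f \<circ> map_d2_ext k"
    have k': "inj_on k' (carrier F8)"
      unfolding k'_def using inj_compose[OF f d2_ext.inj_map[OF k]] inj_on_subset by blast
    note k'_hom = bz_image_inj_hom[OF k']
    have "bz_image k' F8 \<in> ?VF"
      by (rule bz_birkhoff[OF F8.bz_closed bz_closed_image[OF F8.bz_closed k'_hom]])
        (auto intro: bz_sat_image[OF F8.bz_closed k'_hom])
    then have "F8 \<Turnstile>\<^sub>B\<^sub>Z m_equation (t i) (u i)" if "i \<in> I" for i
      using VF that by (intro bz_sat_embedding[OF F8.bz_closed k'_hom k']) blast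
    then have B6_sat: "B6 \<Turnstile>\<^sub>B\<^sub>I (t i, u i)" if "i \<in> I" for i
      using that m_iff[OF that B6.bi_lattice_axioms] by (simp add: F8_def)
    show "?VB = ?OL"
    proof (intro equalityI subsetI)
      fix L assume "L \<in> ?VB"
      then show "L \<in> ?OL" using VB_ortho bi_variety_dest(2) B6_sat by blast
    next
      fix M assume M: "M \<in> ?OL"
      then interpret M: ortholattice M by blast
      interpret DM: pbz_star_lattice "D2_sum M" by (rule M.D2_sum_pbz_star)
      have f': "inj_on f (carrier (D2_sum M))" using f inj_on_subset by blast
      note f_hom = bz_image_inj_hom[OF f']
      define K where "K = bz_image f (D2_sum M)"
      have K_closed: "bz_closed K"
        unfolding K_def by (rule bz_closed_image[OF DM.bz_closed f_hom]) simp
      have K_sat: "K \<Turnstile>\<^sub>B\<^sub>Z p" if "D2_sum M \<Turnstile>\<^sub>B\<^sub>Z p" for p :: "nat bz_term \<times> nat bz_term"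
        unfolding K_def by (rule bz_sat_image[OF DM.bz_closed f_hom _ that]) simp
      have "D2_sum M \<Turnstile>\<^sub>B\<^sub>Z m_equation (t i) (u i)" if "i \<in> I" for i
        using M that m_iff[OF that M.bi_lattice_axioms] by blast
      then have "K \<in> ?PBZ"
        using pbz_star_equational[OF M.D2_sum_pbz_star M.D2_sum_J0 K_closed K_sat]
          K_sat M.D2_sum_J0 M.D2_sum_D2OL by blast
      then have "K \<in> ?VF" using VF by blast
      then have "D2_sum M \<Turnstile>\<^sub>B\<^sub>Z q" if "D2_sum B6 \<Turnstile>\<^sub>B\<^sub>Z q" for q :: "'a bz_term \<times> 'a bz_term"
        using bz_sat_embedding[OF DM.bz_closed f_hom f'] bz_variety_dest(2) that
        unfolding K_def F8_def by blast
      then have "M \<Turnstile>\<^sub>B\<^sub>I p" if "B6 \<Turnstile>\<^sub>B\<^sub>I p" for p :: "'a bi_term \<times> 'a bi_term"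
        using D2_sum_sat_reflect[OF B6_ortholattice M.ortholattice_axioms _ that] by blast
      then show "M \<in> ?VB" by (rule bi_birkhoff[OF B6.bi_closed M.bi_closed])
    qed
  qed
qed

end
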